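(* Let $p\in(1,\infty)$ and let $\mathcal{E}$ be a regular conservative pure-jump Dirichlet form on $L^2(m)$ with domain $\mathcal{D}(\mathcal{E})$, given by $$\mathcal{E}(u,v)=\frac12\iint_{E\times E\setminus\mathrm{diag}}(u(y)-u(x))(v(y)-v(x))\,J(dx,dy).$$ Let $\mathcal{E}_p$ be the corresponding $p$-form with domain $\mathcal{D}(\mathcal{E}_p)$, and let $u\in\mathcal{D}(\mathcal{E}_p)$. Then $u^{\langle p/2\rangle}\in\mathcal{D}(\mathcal{E})$. Moreover, if $u\in C(E)$, then $$\mathcal{E}_p[u]=\frac1p\iint_{E\times E\setminus\mathrm{diag}}F_p(u(x),u(y))\,J(dx,dy).$$
   Context: $E$ is a locally compact separable metric space with Borel $\sigma$-algebra $\mathcal{B}$, and $m$ is a positive Radon measure on $E$ with $\mathrm{supp}(m)=E$. Write $L^p(m):=L^p(E,\mathcal{B},m)$, and $C(E)$ for the continuous real functions on $E$. $\mathrm{diag}:=\{(x,y)\in E\times E: x=y\}$. $J$ (the jumping measure) is a symmetric positive Radon measure on $E\times E\setminus\mathrm{diag}$. The formula for $\mathcal{E}(u,v)$ holds for $u,v\in\mathcal{D}(\mathcal{E})\subseteq L^2(m)$ (with the usual convention that quasi-continuous versions are used in the integral). $(P_t)_{t\ge0}$ is the strongly continuous symmetric Markovian semigroup of contractions on $L^2(m)$ associated with $\mathcal{E}$; it extends to a strongly continuous semigroup of contractions on $L^p(m)$ for every $p\in[1,\infty)$. Conservative means $P_t1=1$ for all $t\geq 0$. For real $a$ and $\kappa>0$,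 $a^{\langle\kappa\rangle}:=|a|^\kappa\,\mathrm{sgn}\,a$. The Bregman divergence is $F_p(a,b):=|b|^p-|a|^p-pa^{\langle p-1\rangle}(b-a)$ for $a,b\in\mathbb{R}$. For $u\in L^p(m)$, $v\in L^q(m)$ with $p^{-1}+q^{-1}=1$, put $\langle u,v\rangle:=\int_E uv\,dm$ and, for $t>0$, $\mathcal{E}^{(t)}(u,v):=\frac1t\langle u-P_tu,v\rangle$. The $p$-form is $$\mathcal{E}_p[u]:=\lim_{t\to0^+}\mathcal{E}^{(t)}\left(u,u^{\langle p-1\rangle}\right),$$ with domain $\mathcal{D}(\mathcal{E}_p)$ consisting of all $u\in L^p(m)$ for which this limit exists and is finite. *)

theory Defs
  imports "HOL-Analysis.Analysis"
begin

section \<open>Measures on the state space\<close>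

text \<open>
  The state space E is the universe of a type \<open>'a\<close>; for metric spaces separability is
  the type class \<^class>\<open>second_countable_topology\<close>.
\<close>

definition offdiag :: "('a \<times> 'a) set" where
  "offdiag = {(x, y). x \<noteq> y}"

definition radon_measure_on :: "'b::topological_space set \<Rightarrow> 'b measure \<Rightarrow> bool" where
  "radon_measure_on S M \<longleftrightarrow>
     space M = S \<and> sets M = sets (restrict_space borel S) \<and>
     (\<forall>K. compact K \<and> K \<subseteq> S \<longrightarrow> emeasure M K < \<infinity>) \<and>
     (\<forall>A\<in>sets M. emeasure M A = (SUP K\<in>{K. compact K \<and> K \<subseteq> A}. emeasure M K))"

definition measure_support :: "'a::topological_space measure \<Rightarrow> 'a set" where
  "measure_support M = {x. \<forall>U. open U \<and> x \<in> U \<longrightarrow> emeasure M U > 0}"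

definition symmetric_measure :: "('a \<times> 'a) measure \<Rightarrow> bool" where
  "symmetric_measure J \<longleftrightarrow> (\<forall>A\<in>sets J. emeasure J (prod.swap ` A) = emeasure J A)"

section \<open>Lebesgue spaces\<close>

text \<open>
  Elements of $L^q(m)$ are represented by measurable functions. Sets of such functions and
  operators on them are understood modulo equality m-almost everywhere.
\<close>

definition Lp_space :: "'a measure \<Rightarrow> real \<Rightarrow> ('a \<Rightarrow> real) set" where
  "Lp_space m q = {u \<in> borel_measurable m. integrable m (\<lambda>x. \<bar>u x\<bar> powr q)}"

definition Lp_norm :: "'a measure \<Rightarrow> real \<Rightarrow> ('a \<Rightarrow> real) \<Rightarrow> real" where
  "Lp_norm m q u = (\<integral>x. \<bar>u x\<bar> powr q \<partial>m) powr (1 / q)"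

definition Linf_space :: "'a measure \<Rightarrow> ('a \<Rightarrow> real) set" where
  "Linf_space m = {u \<in> borel_measurable m. \<exists>c. AE x in m. \<bar>u x\<bar> \<le> c}"

definition pairing :: "'a measure \<Rightarrow> ('a \<Rightarrow> real) \<Rightarrow> ('a \<Rightarrow> real) \<Rightarrow> real" where
  "pairing m u v = (\<integral>x. u x * v x \<partial>m)"

definition linear_mod_AE ::
    "'a measure \<Rightarrow> ('a \<Rightarrow> real) set \<Rightarrow> (('a \<Rightarrow> real) \<Rightarrow> 'a \<Rightarrow> real) \<Rightarrow> bool" where
  "linear_mod_AE m V T \<longleftrightarrow>
     (\<forall>u\<in>V. \<forall>v\<in>V. AE x in m. T (\<lambda>x. u x + v x) x = T u x + T v x) \<and>
     (\<forall>u\<in>V. \<forall>c. AE x in m. T (\<lambda>x. c * u x) x = c * T u x)"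

section \<open>Dirichlet forms\<close>

definition form1 :: "'a measure \<Rightarrow> (('a \<Rightarrow> real) \<Rightarrow> ('a \<Rightarrow> real) \<Rightarrow> real) \<Rightarrow> ('a \<Rightarrow> real) \<Rightarrow> real" where
  "form1 m \<E> u = \<E> u u + pairing m u u"

text \<open>The Markov property is expressed through the unit contraction, and closedness as
  completeness of D for the norm whose square is \<open>form1\<close>. D is saturated under almost
  everywhere equality.\<close>

definition dirichlet_form ::
    "'a measure \<Rightarrow> ('a \<Rightarrow> real) set \<Rightarrow> (('a \<Rightarrow> real) \<Rightarrow> ('a \<Rightarrow> real) \<Rightarrow> real) \<Rightarrow> bool" where
  "dirichlet_form m D \<E> \<longleftrightarrow>
     D \<subseteq> Lp_space m 2 \<and>
     (\<lambda>x. 0) \<in> D \<and>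
     (\<forall>u\<in>D. \<forall>v\<in>D. (\<lambda>x. u x + v x) \<in> D) \<and>
     (\<forall>u\<in>D. \<forall>c. (\<lambda>x. c * u x) \<in> D) \<and>
     (\<forall>u\<in>D. \<forall>v\<in>borel_measurable m. (AE x in m. u x = v x) \<longrightarrow> v \<in> D) \<and>
     (\<forall>u\<in>Lp_space m 2. \<forall>\<epsilon>>0. \<exists>v\<in>D. Lp_norm m 2 (\<lambda>x. u x - v x) < \<epsilon>) \<and>
     (\<forall>u\<in>D. \<forall>v\<in>D. \<E> u v = \<E> v u) \<and>
     (\<forall>u\<in>D. \<forall>v\<in>D. \<forall>w\<in>D. \<E> (\<lambda>x. u x + v x) w = \<E> u w + \<E> v w) \<and>
     (\<forall>u\<in>D. \<forall>v\<in>D. \<forall>c. \<E> (\<lambda>x. c * u x) v = c * \<E> u v) \<and>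
     (\<forall>u\<in>D. 0 \<le> \<E> u u) \<and>
     (\<forall>u\<in>D. \<forall>u'\<in>D. \<forall>v\<in>D. (AE x in m. u x = u' x) \<longrightarrow> \<E> u v = \<E> u' v) \<and>
     (\<forall>w. (\<forall>n. w n \<in> D) \<and>
          (\<forall>\<epsilon>>0. \<exists>N. \<forall>i\<ge>N. \<forall>j\<ge>N. form1 m \<E> (\<lambda>x. w i x - w j x) < \<epsilon>) \<longrightarrow>
          (\<exists>u\<in>D. (\<lambda>n::nat. form1 m \<E> (\<lambda>x. w n x - u x)) \<longlonglongrightarrow> 0)) \<and>
     (\<forall>u\<in>D. (\<lambda>x. min (max (u x) 0) 1) \<in> D \<and>
            \<E> (\<lambda>x. min (max (u x) 0) 1) (\<lambda>x. min (max (u x) 0) 1) \<le> \<E> u u)"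

definition Cc :: "('a::topological_space \<Rightarrow> real) set" where
  "Cc = {f. continuous_on UNIV f \<and> compact (closure {x. f x \<noteq> 0})}"

definition regular_form ::
    "'a::topological_space measure \<Rightarrow> ('a \<Rightarrow> real) set \<Rightarrow>
     (('a \<Rightarrow> real) \<Rightarrow> ('a \<Rightarrow> real) \<Rightarrow> real) \<Rightarrow> bool" where
  "regular_form m D \<E> \<longleftrightarrow>
     (\<forall>u\<in>D. \<forall>\<epsilon>>0. \<exists>v\<in>D \<inter> Cc. form1 m \<E> (\<lambda>x. u x - v x) < \<epsilon>) \<and>
     (\<forall>f\<in>Cc. \<forall>\<epsilon>>0. \<exists>v\<in>D \<inter> Cc. \<forall>x. \<bar>f x - v x\<bar> < \<epsilon>)"

text \<open>The 1-capacity of an open set; it is infinite if there is no admissible function.\<close>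

definition open_capacity ::
    "'a measure \<Rightarrow> ('a \<Rightarrow> real) set \<Rightarrow> (('a \<Rightarrow> real) \<Rightarrow> ('a \<Rightarrow> real) \<Rightarrow> real) \<Rightarrow> 'a set \<Rightarrow> ennreal" where
  "open_capacity m D \<E> G = (INF u\<in>{u\<in>D. AE x in m. x \<in> G \<longrightarrow> 1 \<le> u x}. ennreal (form1 m \<E> u))"

definition quasi_continuous ::
    "'a::topological_space measure \<Rightarrow> ('a \<Rightarrow> real) set \<Rightarrow>
     (('a \<Rightarrow> real) \<Rightarrow> ('a \<Rightarrow> real) \<Rightarrow> real) \<Rightarrow> ('a \<Rightarrow> real) \<Rightarrow> bool" where
  "quasi_continuous m D \<E> f \<longleftrightarrow>
     (\<forall>\<epsilon>>0. \<exists>G. open G \<and> open_capacity m D \<E> G < ennreal \<epsilon> \<and> continuous_on (- G) f)"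

definition qc_version ::
    "'a::topological_space measure \<Rightarrow> ('a \<Rightarrow> real) set \<Rightarrow>
     (('a \<Rightarrow> real) \<Rightarrow> ('a \<Rightarrow> real) \<Rightarrow> real) \<Rightarrow> ('a \<Rightarrow> real) \<Rightarrow> ('a \<Rightarrow> real) \<Rightarrow> bool" where
  "qc_version m D \<E> u f \<longleftrightarrow>
     f \<in> borel_measurable borel \<and> (AE x in m. f x = u x) \<and> quasi_continuous m D \<E> f"

text \<open>The pure-jump form with jumping measure J. The formula does not depend on the choice
  of the Borel quasi-continuous versions; integrability is explicit because the Bochner integral of a
  non-integrable function is 0.\<close>

definition pure_jump ::
    "'a::topological_space measure \<Rightarrow> ('a \<Rightarrow> real) set \<Rightarrow>
     (('a \<Rightarrow> real) \<Rightarrow> ('a \<Rightarrow> real) \<Rightarrow> real) \<Rightarrow> ('a \<times> 'a) measure \<Rightarrow> bool" where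
  "pure_jump m D \<E> J \<longleftrightarrow>
     (\<forall>u\<in>D. \<forall>v\<in>D. \<forall>f g. qc_version m D \<E> u f \<and> qc_version m D \<E> v g \<longrightarrow>
        integrable J (\<lambda>(x, y). (f y - f x) * (g y - g x)) \<and>
        \<E> u v = 1 / 2 * (\<integral>(x, y). (f y - f x) * (g y - g x) \<partial>J))"

section \<open>The semigroup\<close>

text \<open>A single family P acts on representatives from all the spaces $L^q(m)$,
  $1 \le q \le \infty$, that is, P also denotes the extensions of the semigroup on $L^2(m)$.\<close>

definition contraction_semigroup ::
    "'a measure \<Rightarrow> real \<Rightarrow> (real \<Rightarrow> ('a \<Rightarrow> real) \<Rightarrow> 'a \<Rightarrow> real) \<Rightarrow> bool" where
  "contraction_semigroup m q P \<longleftrightarrow>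
     (\<forall>t\<ge>0. \<forall>u\<in>Lp_space m q. P t u \<in> Lp_space m q \<and> Lp_norm m q (P t u) \<le> Lp_norm m q u) \<and>
     (\<forall>t\<ge>0. linear_mod_AE m (Lp_space m q) (P t)) \<and>
     (\<forall>u\<in>Lp_space m q. AE x in m. P 0 u x = u x) \<and>
     (\<forall>s\<ge>0. \<forall>t\<ge>0. \<forall>u\<in>Lp_space m q. AE x in m. P (s + t) u x = P s (P t u) x) \<and>
     (\<forall>u\<in>Lp_space m q. ((\<lambda>t. Lp_norm m q (\<lambda>x. P t u x - u x)) \<longlongrightarrow> 0) (at_right 0))"

definition symmetric_markovian ::
    "'a measure \<Rightarrow> (real \<Rightarrow> ('a \<Rightarrow> real) \<Rightarrow> 'a \<Rightarrow> real) \<Rightarrow> bool" where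
  "symmetric_markovian m P \<longleftrightarrow>
     (\<forall>t\<ge>0. \<forall>u\<in>Lp_space m 2. \<forall>v\<in>Lp_space m 2. pairing m (P t u) v = pairing m u (P t v)) \<and>
     (\<forall>t\<ge>0. \<forall>u\<in>Lp_space m 2. (AE x in m. 0 \<le> u x \<and> u x \<le> 1) \<longrightarrow>
        (AE x in m. 0 \<le> P t u x \<and> P t u x \<le> 1))"

text \<open>On $L^\infty(m)$ the semigroup is defined by linearity and monotone limits of
  nonnegative functions from $L^2(m)$.\<close>

definition Linf_extension ::
    "'a measure \<Rightarrow> (real \<Rightarrow> ('a \<Rightarrow> real) \<Rightarrow> 'a \<Rightarrow> real) \<Rightarrow> bool" where
  "Linf_extension m P \<longleftrightarrow>
     (\<forall>t\<ge>0. (\<forall>u\<in>Linf_space m. P t u \<in> Linf_space m) \<and> linear_mod_AE m (Linf_space m) (P t) \<and>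
        (\<forall>u\<in>Linf_space m. \<forall>w::nat \<Rightarrow> 'a \<Rightarrow> real.
           (\<forall>n. w n \<in> Lp_space m 2) \<and>
           (AE x in m. (\<forall>n. 0 \<le> w n x \<and> w n x \<le> w (Suc n) x) \<and> (\<lambda>n. w n x) \<longlonglongrightarrow> u x) \<longrightarrow>
           (AE x in m. (\<lambda>n. P t (w n) x) \<longlonglongrightarrow> P t u x)))"

definition approx_form ::
    "'a measure \<Rightarrow> (real \<Rightarrow> ('a \<Rightarrow> real) \<Rightarrow> 'a \<Rightarrow> real) \<Rightarrow> real \<Rightarrow>
     ('a \<Rightarrow> real) \<Rightarrow> ('a \<Rightarrow> real) \<Rightarrow> real" where
  "approx_form m P t u v = 1 / t * pairing m (\<lambda>x. u x - P t u x) v"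

text \<open>For u in $L^2(m)$ the quantity \<open>approx_form m P t u u\<close> increases as t decreases to 0,
  so the limit exists in $[0,\infty]$; the domain of the form is where it is finite.\<close>

definition associated ::
    "'a measure \<Rightarrow> ('a \<Rightarrow> real) set \<Rightarrow> (('a \<Rightarrow> real) \<Rightarrow> ('a \<Rightarrow> real) \<Rightarrow> real) \<Rightarrow>
     (real \<Rightarrow> ('a \<Rightarrow> real) \<Rightarrow> 'a \<Rightarrow> real) \<Rightarrow> bool" where
  "associated m D \<E> P \<longleftrightarrow>
     D = {u \<in> Lp_space m 2. \<exists>l. ((\<lambda>t. approx_form m P t u u) \<longlongrightarrow> l) (at_right 0)} \<and>
     (\<forall>u\<in>D. \<forall>v\<in>D. ((\<lambda>t. approx_form m P t u v) \<longlongrightarrow> \<E> u v) (at_right 0))"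

definition form_semigroup ::
    "'a measure \<Rightarrow> ('a \<Rightarrow> real) set \<Rightarrow> (('a \<Rightarrow> real) \<Rightarrow> ('a \<Rightarrow> real) \<Rightarrow> real) \<Rightarrow>
     (real \<Rightarrow> ('a \<Rightarrow> real) \<Rightarrow> 'a \<Rightarrow> real) \<Rightarrow> bool" where
  "form_semigroup m D \<E> P \<longleftrightarrow>
     symmetric_markovian m P \<and> associated m D \<E> P \<and>
     (\<forall>q\<ge>1. contraction_semigroup m q P) \<and> Linf_extension m P"

definition conservative ::
    "'a measure \<Rightarrow> (real \<Rightarrow> ('a \<Rightarrow> real) \<Rightarrow> 'a \<Rightarrow> real) \<Rightarrow> bool" where
  "conservative m P \<longleftrightarrow> (\<forall>t\<ge>0. AE x in m. P t (\<lambda>x. 1) x = 1)"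

section \<open>The p-form\<close>

definition signed_powr :: "real \<Rightarrow> real \<Rightarrow> real" where
  "signed_powr a \<kappa> = \<bar>a\<bar> powr \<kappa> * sgn a"

definition bregman :: "real \<Rightarrow> real \<Rightarrow> real \<Rightarrow> real" where
  "bregman p a b = \<bar>b\<bar> powr p - \<bar>a\<bar> powr p - p * signed_powr a (p - 1) * (b - a)"

definition p_form_domain ::
    "'a measure \<Rightarrow> (real \<Rightarrow> ('a \<Rightarrow> real) \<Rightarrow> 'a \<Rightarrow> real) \<Rightarrow> real \<Rightarrow> ('a \<Rightarrow> real) set" where
  "p_form_domain m P p = {u \<in> Lp_space m p.
     \<exists>l. ((\<lambda>t. approx_form m P t u (\<lambda>x. signed_powr (u x) (p - 1))) \<longlongrightarrow> l) (at_right 0)}"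

definition p_form ::
    "'a measure \<Rightarrow> (real \<Rightarrow> ('a \<Rightarrow> real) \<Rightarrow> 'a \<Rightarrow> real) \<Rightarrow> real \<Rightarrow> ('a \<Rightarrow> real) \<Rightarrow> real" where
  "p_form m P p u = Lim (at_right 0) (\<lambda>t. approx_form m P t u (\<lambda>x. signed_powr (u x) (p - 1)))"

end

theory Submission
  imports Defs
begin

text \<open>
  Write \<open>v = signed_powr u (p / 2)\<close> and let \<open>F\<^sub>p\<close> be the Bregman divergence. If \<open>P\<^sub>t\<close> had a kernel, the
  approximations \<open>approx_form m P t u (signed_powr u (p - 1))\<close> of the \<open>p\<close>-form would be at least
  \<open>1 / (p * t)\<close> times the integral of \<open>F\<^sub>p (u x) (u y)\<close> against \<open>P\<^sub>t(x, dy) m(dx)\<close>, and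
  \<open>F\<^sub>p (u x) (u y)\<close> is comparable with \<open>(v y - v x)\<^sup>2\<close> (\<open>bregman_comparison\<close>). The idea of the proof is
  that such estimates only involve functions of two points that are finite sums of products
  \<open>h x * g y\<close>, and on these no kernel is necessary: positivity can be obtained from
  positivity of \<open>P\<^sub>t\<close> on a countable dense family of linear combinations
  (\<open>P_tensor_pos\<close>). The resulting principle is \<open>powr_comparison\<close>.

  Membership of \<open>v\<close> in the form domain follows at once. The lower comparison bounds
  \<open>approx_form m P t v v\<close> as \<open>t\<close> tends to \<open>0\<close>. By convexity of \<open>t \<mapsto> pairing m (P\<^sub>t v) v\<close> this quantity
  is monotone in \<open>t\<close>, and hence has a finite limit (\<open>approx_form_convergent\<close>).

  For continuous \<open>u\<close> the measures \<open>P\<^sub>t(x, dy) m(dx) / t\<close> converge to \<open>J\<close> off the diagonal, in the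
  sense that \<open>pairing m (P\<^sub>t g) f / t\<close> tends to the integral of \<open>f x * g y\<close> with respect to \<open>J\<close> for
  nonnegative continuous \<open>f\<close>, \<open>g\<close> in the domain with \<open>f * g = 0\<close> (\<open>offdiagonal_limit\<close>). A continuous
  nonnegative function of \<open>(v x, v y)\<close> that vanishes on the diagonal is the pointwise limit from below of
  sums of such products, built from hat functions of \<open>v\<close> (\<open>step_minorants\<close>), so a Fatou
  argument bounds its \<open>J\<close>-integral (\<open>jump_lower_bound\<close>). Applied to \<open>F\<^sub>p\<close> this yields one
  inequality between the integral of \<open>F\<^sub>p\<close> and the \<open>p\<close>-form. Applied to
  \<open>C * (v y - v x)\<^sup>2 - F\<^sub>p\<close> it yields the other one, because \<open>v\<close> is a continuous element of the
  domain, for which the form is the integral of \<open>(v y - v x)\<^sup>2 / 2\<close>.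
\<close>

section \<open>Signed powers and the Bregman divergence\<close>

lemma signed_powr_nonneg: "0 \<le> a \<Longrightarrow> signed_powr a k = (if a = 0 then 0 else a powr k)"
  by (simp add: signed_powr_def)

lemma signed_powr_minus [simp]: "signed_powr (- a) k = - signed_powr a k"
  by (simp add: signed_powr_def)

lemma abs_signed_powr: "\<bar>signed_powr a k\<bar> = \<bar>a\<bar> powr k"
  by (cases "a = 0") (simp_all add: signed_powr_def abs_mult abs_sgn_eq)

lemma signed_powr_half_square: "(signed_powr a (p / 2))\<^sup>2 = \<bar>a\<bar> powr p"
proof -
  have "(signed_powr a (p / 2))\<^sup>2 = (\<bar>a\<bar> powr (p / 2))\<^sup>2"
    by (metis abs_signed_powr power2_abs)
  also have "\<dots> = \<bar>a\<bar> powr p"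
    by (simp add: power2_eq_square flip: powr_add)
  finally show ?thesis .
qed

lemma signed_powr_mult_self: "signed_powr a (p - 1) * a = \<bar>a\<bar> powr p"
proof (cases "a = 0")
  case False
  have "signed_powr a (p - 1) * a = \<bar>a\<bar> powr (p - 1) * \<bar>a\<bar>"
    by (simp add: signed_powr_def abs_sgn)
  also have "\<dots> = \<bar>a\<bar> powr p"
    using False by (simp add: powr_mult_base[symmetric] powr_diff)
  finally show ?thesis .
qed (simp add: signed_powr_def)

lemma signed_powr_signed_powr:
  "signed_powr (signed_powr a k) l = signed_powr a (k * l)"
  by (cases "a = 0") (auto simp: signed_powr_def abs_mult abs_sgn_eq powr_powr sgn_mult)

lemma signed_powr_1 [simp]: "signed_powr a 1 = a"
  by (simp add: signed_powr_def abs_mult_sgn)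

lemma continuous_on_signed_powr [continuous_intros]:
  fixes f :: "'b::topological_space \<Rightarrow> real"
  assumes "continuous_on S f" "0 < k"
  shows "continuous_on S (\<lambda>x. signed_powr (f x) k)"
proof -
  have eq: "signed_powr a k = (max a 0) powr k - (max (- a) 0) powr k" for a
    using assms(2) by (cases a "0::real" rule: linorder_cases) (auto simp: signed_powr_def max_def)
  show ?thesis
    unfolding eq using assms by (intro continuous_intros continuous_on_powr') auto
qed

lemma borel_measurable_signed_powr [measurable]:
  assumes [measurable]: "f \<in> borel_measurable M"
  shows "(\<lambda>x. signed_powr (f x) k) \<in> borel_measurable M"
  unfolding signed_powr_def by measurable

lemma bregman_eq:
  "bregman p a b = \<bar>b\<bar> powr p + (p - 1) * \<bar>a\<bar> powr p - p * (signed_powr a (p - 1) * b)"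
  by (simp add: bregman_def algebra_simps flip: signed_powr_mult_self)

lemma bregman_minus: "bregman p (- a) (- b) = bregman p a b"
  by (simp add: bregman_eq)

text \<open>
  In terms of \<open>X = a powr (p / 2)\<close>, \<open>Y = b powr (p / 2)\<close> and \<open>Z = a powr (p - 1) * b\<close> the claims
  become linear in \<open>X\<^sup>2\<close>, \<open>Y\<^sup>2\<close>, \<open>X * Y\<close> and \<open>Z\<close>. Since \<open>Z\<close> is a weighted geometric mean
  of \<open>X * Y\<close> and one of the squares, and \<open>X * Y\<close> is one of \<open>Z\<close> and the other square (which one
  depends on whether \<open>p \<ge> 2\<close>), both follow from the weighted inequality of the arithmetic and
  geometric mean.
\<close>

lemma bregman_comparison_same_sign:
  assumes p: "1 < p" and a: "0 < a" and b: "0 < (b::real)"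
  defines "d \<equiv> b powr (p / 2) - a powr (p / 2)"
  shows "min 1 (p - 1) * d\<^sup>2 \<le> bregman p a b"
    and "bregman p a b \<le> max 1 (p - 1) * d\<^sup>2"
proof -
  define X Y Z where "X = a powr (p / 2)" and "Y = b powr (p / 2)" and "Z = a powr (p - 1) * b"
  have X2: "X\<^sup>2 = a powr p" and Y2: "Y\<^sup>2 = b powr p"
    by (simp_all add: X_def Y_def power2_eq_square flip: powr_add)
  have F: "bregman p a b = Y\<^sup>2 + (p - 1) * X\<^sup>2 - p * Z"
    using a b by (simp add: bregman_eq X2 Y2 Z_def signed_powr_def)
  have d: "d\<^sup>2 = Y\<^sup>2 + X\<^sup>2 - 2 * (X * Y)"
    by (simp add: d_def X_def Y_def power2_eq_square algebra_simps)
  have XY: "X * Y = exp (p / 2 * ln a + p / 2 * ln b)"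
    using a b by (simp add: X_def Y_def powr_def exp_add)
  have X2e: "X\<^sup>2 = exp (p * ln a)" and Y2e: "Y\<^sup>2 = exp (p * ln b)"
    using a b by (simp_all add: X2 Y2 powr_def)
  have Ze: "Z = exp ((p - 1) * ln a + ln b)"
    using a b by (simp add: Z_def powr_def exp_add)
  have young: "exp (r * s + (1 - r) * t) \<le> r * exp s + (1 - r) * exp t"
    if "0 \<le> r" "r \<le> 1" for r s t :: real
    using Youngs_inequality_0[of r "1 - r" "exp s" "exp t"] that
    by (simp add: powr_def exp_add)
  consider "2 \<le> p" | "p < 2" by linarith
  then have "min 1 (p - 1) * d\<^sup>2 \<le> bregman p a b \<and> bregman p a b \<le> max 1 (p - 1) * d\<^sup>2"
  proof cases
    case 1
    have "Z \<le> (1 - 2 / p) * X\<^sup>2 + (1 - (1 - 2 / p)) * (X * Y)"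
      unfolding XY X2e Ze using 1 p
      by (intro order_trans[OF eq_refl young]) (auto simp: field_simps)
    then have "p * Z \<le> p * ((1 - 2 / p) * X\<^sup>2 + (1 - (1 - 2 / p)) * (X * Y))"
      using p by (intro mult_left_mono) auto
    also have "\<dots> = (p - 2) * X\<^sup>2 + 2 * (X * Y)"
      using p by (simp add: field_simps)
    finally have Z1: "p * Z \<le> (p - 2) * X\<^sup>2 + 2 * (X * Y)" .
    define w where "w = (p - 2) / (2 * p - 2)"
    have w: "(2 * p - 2) * w = p - 2"
      using p nonzero_eq_divide_eq[of "2 * p - 2" w "p - 2"] by (simp add: w_def mult.commute)
    have w01: "0 \<le> w" "w \<le> 1"
      using 1 p by (simp_all add: w_def)
    have "w * (p * ln b) + (1 - w) * ((p - 1) * ln a + ln b) = p / 2 * ln a + p / 2 * ln b"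
    proof -
      have "w * (p * ln b) + (1 - w) * ((p - 1) * ln a + ln b) =
          ((1 - w) * (p - 1)) * ln a + (w * p + (1 - w)) * ln b"
        by (simp add: algebra_simps)
      moreover have "(1 - w) * (p - 1) = p / 2" "w * p + (1 - w) = p / 2"
        using w by (simp_all add: algebra_simps)
      ultimately show ?thesis
        by simp
    qed
    then have "X * Y \<le> w * Y\<^sup>2 + (1 - w) * Z"
      unfolding XY Y2e Ze using young[OF w01] by metis
    then have "(2 * p - 2) * (X * Y) \<le> (2 * p - 2) * (w * Y\<^sup>2 + (1 - w) * Z)"
      using p by (intro mult_left_mono) auto
    also have "\<dots> = ((2 * p - 2) * w) * Y\<^sup>2 + ((2 * p - 2) - (2 * p - 2) * w) * Z"
      by (simp add: algebra_simps)
    also have "\<dots> = (p - 2) * Y\<^sup>2 + p * Z"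
      unfolding w by simp
    finally have Z2: "(2 * p - 2) * (X * Y) \<le> (p - 2) * Y\<^sup>2 + p * Z" .
    show ?thesis
      unfolding F d using 1 Z1 Z2 by (simp add: min_def max_def algebra_simps)
  next
    case 2
    have "Z \<le> (2 / p - 1) * Y\<^sup>2 + (1 - (2 / p - 1)) * (X * Y)"
      unfolding XY Y2e Ze using 2 p
      by (intro order_trans[OF eq_refl young]) (auto simp: field_simps)
    then have "p * Z \<le> p * ((2 / p - 1) * Y\<^sup>2 + (1 - (2 / p - 1)) * (X * Y))"
      using p by (intro mult_left_mono) auto
    also have "\<dots> = (2 - p) * Y\<^sup>2 + (2 * p - 2) * (X * Y)"
      using p by (simp add: field_simps)
    finally have Z1: "p * Z \<le> (2 - p) * Y\<^sup>2 + (2 * p - 2) * (X * Y)" .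
    have "X * Y \<le> ((2 - p) / 2) * X\<^sup>2 + (1 - (2 - p) / 2) * Z"
      unfolding XY X2e Ze using 2 p
      by (intro order_trans[OF eq_refl young]) (auto simp: field_simps)
    then have Z2: "2 * (X * Y) \<le> (2 - p) * X\<^sup>2 + p * Z"
      by (simp add: field_simps)
    show ?thesis
      unfolding F d using 2 Z1 Z2 by (simp add: min_def max_def algebra_simps)
  qed
  then show "min 1 (p - 1) * d\<^sup>2 \<le> bregman p a b" "bregman p a b \<le> max 1 (p - 1) * d\<^sup>2"
    by blast+
qed

text \<open>
  For arguments of opposite sign nothing cancels: the mixed term of the Bregman divergence is
  nonnegative and bounded by the two squares through Young's inequality, and the square of the
  difference lies between the sum of the squares and twice that sum.
\<close>

lemma bregman_comparison_opposite_sign: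
  assumes p: "1 < p" and a: "0 \<le> a" and b: "b \<le> (0::real)"
  defines "d \<equiv> signed_powr b (p / 2) - signed_powr a (p / 2)"
  shows "min 1 (p - 1) / 2 * d\<^sup>2 \<le> bregman p a b"
    and "bregman p a b \<le> 2 * max 1 (p - 1) * d\<^sup>2"
proof -
  define X Y Z where "X = signed_powr a (p / 2)" and "Y = - signed_powr b (p / 2)"
    and "Z = - (signed_powr a (p - 1) * b)"
  have X2: "X\<^sup>2 = \<bar>a\<bar> powr p" and Y2: "Y\<^sup>2 = \<bar>b\<bar> powr p"
    by (simp_all add: X_def Y_def signed_powr_half_square)
  have nn: "0 \<le> X" "0 \<le> Y" "0 \<le> Z"
    using a b by (auto simp: X_def Y_def Z_def signed_powr_def mult_nonneg_nonpos mult_nonneg_nonpos2 sgn_if)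
  have F: "bregman p a b = Y\<^sup>2 + (p - 1) * X\<^sup>2 + p * Z"
    by (simp add: bregman_eq X2 Y2 Z_def)
  have d: "d\<^sup>2 = (X + Y)\<^sup>2"
    by (simp add: d_def X_def Y_def power2_eq_square algebra_simps)
  have d_le: "d\<^sup>2 \<le> 2 * (X\<^sup>2 + Y\<^sup>2)"
    unfolding d using sum_squares_bound[of X Y] by (simp add: power2_sum)
  have d_ge: "X\<^sup>2 + Y\<^sup>2 \<le> d\<^sup>2"
    unfolding d using nn by (simp add: power2_sum)
  have "\<bar>b\<bar> * \<bar>a\<bar> powr (p - 1) \<le> \<bar>b\<bar> powr p / p + (\<bar>a\<bar> powr (p - 1)) powr (p / (p - 1)) / (p / (p - 1))"
    using p by (intro Youngs_inequality) (auto simp: field_simps)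
  then have "Z \<le> Y\<^sup>2 / p + X\<^sup>2 / (p / (p - 1))"
    using p a b by (auto simp: Z_def X2 Y2 powr_powr signed_powr_def sgn_if mult.commute split: if_splits)
  then have "p * Z \<le> p * (Y\<^sup>2 / p + X\<^sup>2 / (p / (p - 1)))"
    using p by (intro mult_left_mono) auto
  also have "\<dots> = Y\<^sup>2 + (p - 1) * X\<^sup>2"
    using p by (simp add: field_simps)
  finally have Z: "p * Z \<le> Y\<^sup>2 + (p - 1) * X\<^sup>2" .
  have "min 1 (p - 1) / 2 * d\<^sup>2 \<le> min 1 (p - 1) / 2 * (2 * (X\<^sup>2 + Y\<^sup>2))"
    using p d_le by (intro mult_left_mono) auto
  also have "\<dots> = min 1 (p - 1) * X\<^sup>2 + min 1 (p - 1) * Y\<^sup>2"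
    by (simp add: algebra_simps)
  also have "\<dots> \<le> (p - 1) * X\<^sup>2 + 1 * Y\<^sup>2"
    by (intro add_mono mult_right_mono) auto
  also have "\<dots> \<le> bregman p a b"
    using p nn unfolding F by simp
  finally show "min 1 (p - 1) / 2 * d\<^sup>2 \<le> bregman p a b" .
  have "bregman p a b \<le> 2 * ((p - 1) * X\<^sup>2 + 1 * Y\<^sup>2)"
    using Z unfolding F by simp
  also have "\<dots> \<le> 2 * (max 1 (p - 1) * X\<^sup>2 + max 1 (p - 1) * Y\<^sup>2)"
    by (intro mult_left_mono add_mono mult_right_mono) auto
  also have "\<dots> = 2 * max 1 (p - 1) * (X\<^sup>2 + Y\<^sup>2)"
    by (simp add: algebra_simps)
  also have "\<dots> \<le> 2 * max 1 (p - 1) * d\<^sup>2"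
    using d_ge by (intro mult_left_mono) auto
  finally show "bregman p a b \<le> 2 * max 1 (p - 1) * d\<^sup>2" .
qed

text \<open>
  The two-sided comparison of \<open>F\<^sub>p\<close> with a square. The constants are not the best ones; what matters
  is that the lower one is at most, and the upper one at least, both \<open>1\<close> and \<open>p - 1\<close>, so
  that after moving everything to one side the pure powers keep nonnegative coefficients, as
  required in \<open>powr_comparison\<close> below.
\<close>

lemma bregman_comparison:
  assumes p: "1 < p"
  shows "min 1 (p - 1) / 2 * (signed_powr b (p / 2) - signed_powr a (p / 2))\<^sup>2 \<le> bregman p a b"
      (is "?l a b \<le> _")
    and "bregman p a b \<le> 2 * max 1 (p - 1) * (signed_powr b (p / 2) - signed_powr a (p / 2))\<^sup>2"
      (is "_ \<le> ?u a b")
proof -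
  have nonneg: "?l a b \<le> bregman p a b \<and> bregman p a b \<le> ?u a b" if a: "0 \<le> a" for a b :: real
  proof (cases "0 < a \<and> 0 < b")
    case True
    let ?d = "(b powr (p / 2) - a powr (p / 2))\<^sup>2"
    have "min 1 (p - 1) / 2 * ?d \<le> min 1 (p - 1) * ?d" "max 1 (p - 1) * ?d \<le> 2 * max 1 (p - 1) * ?d"
      using p by (auto intro!: mult_right_mono)
    with bregman_comparison_same_sign[OF p, of a b] True show ?thesis
      by (simp add: signed_powr_nonneg)
  next
    case False
    show ?thesis
    proof (cases "b \<le> 0")
      case True
      then show ?thesis
        using bregman_comparison_opposite_sign[OF p a True] by simp
    next
      case b: False
      with False a have "a = 0" by simp
      \<comment> \<open>For \<open>a = 0\<close> all three expressions are even in \<open>b\<close>.\<close>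
      then show ?thesis
        using bregman_comparison_opposite_sign[OF p a, of "- b"] b
        by (simp add: bregman_eq signed_powr_def[of 0])
    qed
  qed
  have "?l a b \<le> bregman p a b \<and> bregman p a b \<le> ?u a b"
  proof (cases "0 \<le> a")
    case False
    have "(signed_powr (- b) (p / 2) - signed_powr (- a) (p / 2))\<^sup>2 =
        (signed_powr b (p / 2) - signed_powr a (p / 2))\<^sup>2"
      by (simp add: power2_commute)
    with nonneg[of "- a" "- b"] False show ?thesis
      by (simp only: bregman_minus)
  qed (rule nonneg)
  then show "?l a b \<le> bregman p a b" "bregman p a b \<le> ?u a b"
    by blast+
qed

section \<open>Lebesgue spaces\<close>

lemma powr_2: "\<bar>a::real\<bar> powr 2 = a\<^sup>2"
  by (cases "a = 0") (simp_all add: powr_numeral)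

lemma Lp_space_2: "u \<in> Lp_space m 2 \<longleftrightarrow> u \<in> borel_measurable m \<and> integrable m (\<lambda>x. (u x)\<^sup>2)"
  by (simp add: Lp_space_def powr_2)

lemma Lp_space_integrable: "u \<in> Lp_space m q \<Longrightarrow> integrable m (\<lambda>x. \<bar>u x\<bar> powr q)"
  by (simp add: Lp_space_def)

lemma Lp_space_dominated:
  assumes "u \<in> Lp_space m q" "v \<in> borel_measurable m" "0 \<le> q"
    and "\<And>x. x \<in> space m \<Longrightarrow> \<bar>v x\<bar> \<le> \<bar>u x\<bar>"
  shows "v \<in> Lp_space m q"
proof -
  have [measurable]: "v \<in> borel_measurable m" by fact
  have "integrable m (\<lambda>x. \<bar>v x\<bar> powr q)"
    by (rule Bochner_Integration.integrable_bound[OF Lp_space_integrable[OF assms(1)]])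
       (use assms(3,4) in \<open>auto intro!: powr_mono2\<close>)
  then show ?thesis using assms(2) by (simp add: Lp_space_def)
qed

lemma Lp_space_scale:
  assumes "u \<in> Lp_space m q" shows "(\<lambda>x. c * u x) \<in> Lp_space m q"
  using assms by (auto simp: Lp_space_def abs_mult powr_mult)

lemma abs_add_powr_le: "\<bar>a + b :: real\<bar> powr q \<le> 2 powr q * (\<bar>a\<bar> powr q + \<bar>b\<bar> powr q)" if "0 \<le> q"
proof -
  have "\<bar>a + b\<bar> powr q \<le> (2 * max \<bar>a\<bar> \<bar>b\<bar>) powr q"
    using that by (intro powr_mono2) auto
  also have "\<dots> = 2 powr q * (max \<bar>a\<bar> \<bar>b\<bar>) powr q"
    by (simp add: powr_mult)
  also have "\<dots> \<le> 2 powr q * (\<bar>a\<bar> powr q + \<bar>b\<bar> powr q)"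
    by (intro mult_left_mono) (auto simp: max_def)
  finally show ?thesis .
qed

lemma Lp_space_add:
  assumes u: "u \<in> Lp_space m q" and v: "v \<in> Lp_space m q" and q: "0 \<le> q"
  shows "(\<lambda>x. u x + v x) \<in> Lp_space m q"
proof -
  have [measurable]: "u \<in> borel_measurable m" "v \<in> borel_measurable m"
    using u v by (simp_all add: Lp_space_def)
  have "integrable m (\<lambda>x. 2 powr q * (\<bar>u x\<bar> powr q + \<bar>v x\<bar> powr q))"
    using u v by (auto simp: Lp_space_def)
  then have "integrable m (\<lambda>x. \<bar>u x + v x\<bar> powr q)"
    by (rule Bochner_Integration.integrable_bound) (use abs_add_powr_le[OF q] in auto)
  then show ?thesis by (simp add: Lp_space_def)
qed

lemma Lp_space_diff:
  assumes "u \<in> Lp_space m q" "v \<in> Lp_space m q" "0 \<le> q"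
  shows "(\<lambda>x. u x - v x) \<in> Lp_space m q"
  using Lp_space_add[OF assms(1) Lp_space_scale[OF assms(2), of "- 1"] assms(3)] by simp

lemma Lp_space_zero: "(\<lambda>x. 0) \<in> Lp_space m q"
  by (simp add: Lp_space_def)

lemma Lp_space_sum:
  fixes g :: "nat \<Rightarrow> 'b \<Rightarrow> real"
  assumes "\<And>i. i < n \<Longrightarrow> g i \<in> Lp_space m q" "0 \<le> q"
  shows "(\<lambda>x. \<Sum>i<n. g i x) \<in> Lp_space m q"
  using assms by (induction n) (auto intro: Lp_space_zero Lp_space_add)

lemma Lp_norm_powr:
  assumes "u \<in> Lp_space m q" "0 < q"
  shows "Lp_norm m q u powr q = (\<integral>x. \<bar>u x\<bar> powr q \<partial>m)"
  using assms by (simp add: Lp_norm_def powr_powr)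

text \<open>
  Young's inequality with a free parameter takes the place of Hoelder's inequality: letting \<open>\<eta>\<close>
  be small makes the first term small uniformly, and then the second term is controlled by the
  \<open>L\<^sup>q\<close> distance.
\<close>

lemma young_parameter:
  fixes a b \<eta> q :: real
  assumes "1 < q" "0 < \<eta>"
  shows "\<bar>a * b\<bar> \<le> \<eta> powr (q / (q - 1)) * \<bar>a\<bar> powr (q / (q - 1)) + \<eta> powr - q * \<bar>b\<bar> powr q"
proof -
  let ?q = "q / (q - 1)"
  have q': "1 < ?q" using assms by simp
  have "\<bar>a * b\<bar> = (\<eta> * \<bar>a\<bar>) * (\<bar>b\<bar> / \<eta>)"
    using assms by (simp add: abs_mult)
  also have "\<dots> \<le> (\<eta> * \<bar>a\<bar>) powr ?q / ?q + (\<bar>b\<bar> / \<eta>) powr q / q"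
    using assms q' by (intro Youngs_inequality) (auto simp: field_simps)
  also have "\<dots> \<le> (\<eta> * \<bar>a\<bar>) powr ?q + (\<bar>b\<bar> / \<eta>) powr q"
  proof -
    have "s / r \<le> s" if "0 \<le> s" "1 < r" for s r :: real
      using that by (simp add: divide_le_eq mult_le_cancel_left1)
    from this[of "(\<eta> * \<bar>a\<bar>) powr ?q" ?q] this[of "(\<bar>b\<bar> / \<eta>) powr q" q] show ?thesis
      using assms(1) q' by (intro add_mono) simp_all
  qed
  also have "\<dots> = \<eta> powr ?q * \<bar>a\<bar> powr ?q + \<eta> powr - q * \<bar>b\<bar> powr q"
    using assms by (simp add: powr_mult powr_divide powr_minus_divide)
  finally show ?thesis .
qed

lemma integrable_mult_Lp:
  assumes q: "1 < q" and f: "f \<in> Lp_space m (q / (q - 1))" and g: "g \<in> Lp_space m q"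
  shows "integrable m (\<lambda>x. g x * f x)"
proof -
  have [measurable]: "f \<in> borel_measurable m" "g \<in> borel_measurable m"
    using f g by (simp_all add: Lp_space_def)
  have "integrable m (\<lambda>x. \<bar>f x\<bar> powr (q / (q - 1)) + \<bar>g x\<bar> powr q)"
    using f g by (auto simp: Lp_space_def)
  then show ?thesis
    by (rule Bochner_Integration.integrable_bound)
       (use young_parameter[OF q, of 1] in \<open>auto simp: mult.commute abs_mult\<close>)
qed

lemma integrable_mult_L2:
  assumes "f \<in> Lp_space m 2" "g \<in> Lp_space m 2"
  shows "integrable m (\<lambda>x. g x * f x)"
  using integrable_mult_Lp[of 2 f m g] assms by simp

lemma tendsto_mult_indicator:
  assumes "incseq B" "(\<Union>n. B n) = space m" "x \<in> space m"
  shows "eventually (\<lambda>n. indicator (B n) x = (1::real)) sequentially"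
proof -
  obtain N where "x \<in> B N" using assms by blast
  then have "x \<in> B n" if "N \<le> n" for n
    using incseqD[OF assms(1) that] by blast
  then show ?thesis
    unfolding eventually_sequentially by (intro exI[of _ N]) simp
qed

section \<open>Markovian semigroups\<close>

locale markovian_semigroup = sigma_finite_measure m
  for m :: "'a measure" +
  fixes P :: "real \<Rightarrow> ('a \<Rightarrow> real) \<Rightarrow> 'a \<Rightarrow> real"
  assumes symmetric_markovian: "symmetric_markovian m P"
    and contraction_semigroup: "\<And>q. 1 \<le> q \<Longrightarrow> contraction_semigroup m q P"
begin

lemma P_Lp: "1 \<le> q \<Longrightarrow> 0 \<le> t \<Longrightarrow> u \<in> Lp_space m q \<Longrightarrow> P t u \<in> Lp_space m q"
  using contraction_semigroup by (simp add: contraction_semigroup_def)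

lemma P_contraction:
  assumes "1 \<le> q" "0 \<le> t" "u \<in> Lp_space m q"
  shows "(\<integral>x. \<bar>P t u x\<bar> powr q \<partial>m) \<le> (\<integral>x. \<bar>u x\<bar> powr q \<partial>m)"
proof -
  have "Lp_norm m q (P t u) \<le> Lp_norm m q u"
    using contraction_semigroup assms by (simp add: contraction_semigroup_def)
  then have "Lp_norm m q (P t u) powr q \<le> Lp_norm m q u powr q"
    using assms(1) by (intro powr_mono2) (auto simp: Lp_norm_def)
  then show ?thesis
    using assms P_Lp[OF assms] by (simp add: Lp_norm_powr)
qed

lemma P_add:
  "1 \<le> q \<Longrightarrow> 0 \<le> t \<Longrightarrow> u \<in> Lp_space m q \<Longrightarrow> v \<in> Lp_space m q \<Longrightarrow>
    AE x in m. P t (\<lambda>x. u x + v x) x = P t u x + P t v x"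
  using contraction_semigroup by (simp add: contraction_semigroup_def linear_mod_AE_def)

lemma P_scale:
  "1 \<le> q \<Longrightarrow> 0 \<le> t \<Longrightarrow> u \<in> Lp_space m q \<Longrightarrow> AE x in m. P t (\<lambda>x. c * u x) x = c * P t u x"
  using contraction_semigroup by (simp add: contraction_semigroup_def linear_mod_AE_def)

lemma P_diff:
  assumes "1 \<le> q" "0 \<le> t" "u \<in> Lp_space m q" "v \<in> Lp_space m q"
  shows "AE x in m. P t (\<lambda>x. u x - v x) x = P t u x - P t v x"
  using P_add[OF assms(1,2,3) Lp_space_scale[OF assms(4)], of "- 1"] P_scale[OF assms(1,2,4), of "- 1"]
  by eventually_elim simp

lemma P_sum:
  fixes g :: "nat \<Rightarrow> 'a \<Rightarrow> real"
  assumes "1 \<le> q" "0 \<le> t" "\<And>i. i < n \<Longrightarrow> g i \<in> Lp_space m q"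
  shows "AE x in m. P t (\<lambda>x. \<Sum>i<n. c i * g i x) x = (\<Sum>i<n. c i * P t (g i) x)"
  using assms(3)
proof (induction n)
  case 0
  show ?case
    using P_scale[OF assms(1,2) Lp_space_zero, of 0] by simp
next
  case (Suc n)
  have "(\<lambda>x. \<Sum>i<n. c i * g i x) \<in> Lp_space m q"
    using Suc.prems assms(1) by (intro Lp_space_sum Lp_space_scale) auto
  then have "AE x in m. P t (\<lambda>x. (\<Sum>i<n. c i * g i x) + c n * g n x) x =
      P t (\<lambda>x. \<Sum>i<n. c i * g i x) x + P t (\<lambda>x. c n * g n x) x"
    using Suc.prems assms(1,2) by (intro P_add Lp_space_scale) auto
  moreover have "AE x in m. P t (\<lambda>x. c n * g n x) x = c n * P t (g n) x"
    using Suc.prems assms(1,2) by (intro P_scale) auto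
  moreover have "AE x in m. P t (\<lambda>x. \<Sum>i<n. c i * g i x) x = (\<Sum>i<n. c i * P t (g i) x)"
    using Suc by simp
  ultimately show ?case
    by eventually_elim simp
qed

lemma P_Markov:
  "0 \<le> t \<Longrightarrow> u \<in> Lp_space m 2 \<Longrightarrow> AE x in m. 0 \<le> u x \<and> u x \<le> 1 \<Longrightarrow>
    AE x in m. 0 \<le> P t u x \<and> P t u x \<le> 1"
  using symmetric_markovian by (simp add: symmetric_markovian_def)

text \<open>
  Boundedness allows rescaling to the unit interval, where the Markov property applies.
\<close>

lemma P_pos:
  assumes t: "0 \<le> t" and g: "g \<in> Lp_space m 2"
    and bounds: "\<And>x. x \<in> space m \<Longrightarrow> 0 \<le> g x \<and> g x \<le> C"
  shows "AE x in m. 0 \<le> P t g x"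
proof -
  define M where "M = max C 1"
  have M: "0 < M" and gM: "\<And>x. x \<in> space m \<Longrightarrow> g x \<le> M"
    using bounds by (simp_all add: M_def le_max_iff_disj)
  have "AE x in m. 0 \<le> 1 / M * g x \<and> 1 / M * g x \<le> 1"
    using bounds gM M by (intro AE_I2) (simp add: divide_le_eq)
  then have "AE x in m. 0 \<le> P t (\<lambda>x. 1 / M * g x) x \<and> P t (\<lambda>x. 1 / M * g x) x \<le> 1"
    by (rule P_Markov[OF t Lp_space_scale[OF g]])
  then have "AE x in m. 0 \<le> P t (\<lambda>x. 1 / M * g x) x"
    by (rule eventually_mono) simp
  moreover have "AE x in m. P t (\<lambda>x. 1 / M * g x) x = 1 / M * P t g x"
    using t g by (intro P_scale[of 2]) auto
  ultimately show ?thesis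
  proof eventually_elim
    case (elim x)
    then have "0 \<le> 1 / M * P t g x"
      by simp
    then show ?case
      using M by (simp add: zero_le_divide_iff)
  qed
qed

text \<open>
  This replaces integration against a transition kernel of \<open>P t\<close>: a nonnegative finite sum of
  products \<open>h i x * g i y\<close> stays nonnegative when \<open>P t\<close> acts on the variable \<open>y\<close> and \<open>y\<close> is then set
  equal to \<open>x\<close>. For a fixed coefficient vector positivity holds up to a null set; the vectors
  \<open>h x\<close> form an uncountable family, so the null sets are collected only along a countable dense
  set of admissible coefficient vectors, and the remaining vectors are reached by closedness.
\<close>

lemma P_tensor_pos:
  fixes h g :: "nat \<Rightarrow> 'a \<Rightarrow> real"
  assumes t: "0 \<le> t"
    and g: "\<And>i. i < n \<Longrightarrow> g i \<in> Lp_space m 2"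
    and bounded: "\<And>i. i < n \<Longrightarrow> \<exists>C. \<forall>x\<in>space m. \<bar>g i x\<bar> \<le> C"
    and nonneg: "\<And>x y. x \<in> space m \<Longrightarrow> y \<in> space m \<Longrightarrow> 0 \<le> (\<Sum>i<n. h i x * g i y)"
  shows "AE x in m. 0 \<le> (\<Sum>i<n. h i x * P t (g i) x)"
proof -
  define S :: "(nat \<Rightarrow> real) set" where
    "S = {c. \<forall>y\<in>space m. 0 \<le> (\<Sum>i<n. c i * g i y)}"
  obtain T where T: "countable T" "T \<subseteq> S" "S \<subseteq> closure T"
    using separable[of S] by blast
  have "\<forall>i\<in>{..<n}. \<exists>C. \<forall>x\<in>space m. \<bar>g i x\<bar> \<le> C"
    using bounded by simp
  from bchoice[OF this] obtain C where C: "\<And>i x. i < n \<Longrightarrow> x \<in> space m \<Longrightarrow> \<bar>g i x\<bar> \<le> C i"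
    by auto
  have "AE x in m. 0 \<le> (\<Sum>i<n. c i * P t (g i) x)" if c: "c \<in> T" for c
  proof -
    have "(\<lambda>y. \<Sum>i<n. c i * g i y) \<in> Lp_space m 2"
      using g by (intro Lp_space_sum Lp_space_scale) auto
    moreover have "0 \<le> (\<Sum>i<n. c i * g i y) \<and> (\<Sum>i<n. c i * g i y) \<le> (\<Sum>i<n. \<bar>c i\<bar> * C i)"
      if y: "y \<in> space m" for y
    proof
      show "0 \<le> (\<Sum>i<n. c i * g i y)"
        using c T(2) y by (auto simp: S_def)
      show "(\<Sum>i<n. c i * g i y) \<le> (\<Sum>i<n. \<bar>c i\<bar> * C i)"
      proof (rule sum_mono)
        fix i assume "i \<in> {..<n}"
        then show "c i * g i y \<le> \<bar>c i\<bar> * C i"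
          using mult_left_mono[OF C[of i y], of "\<bar>c i\<bar>"] y abs_ge_self[of "c i * g i y"]
          by (simp add: abs_mult)
      qed
    qed
    ultimately have "AE x in m. 0 \<le> P t (\<lambda>y. \<Sum>i<n. c i * g i y) x"
      by (intro P_pos[OF t, where C = "\<Sum>i<n. \<bar>c i\<bar> * C i"]) auto
    moreover have "AE x in m. P t (\<lambda>y. \<Sum>i<n. c i * g i y) x = (\<Sum>i<n. c i * P t (g i) x)"
      using t g by (intro P_sum[of 2]) auto
    ultimately show ?thesis
      by eventually_elim simp
  qed
  then have "AE x in m. \<forall>c\<in>T. 0 \<le> (\<Sum>i<n. c i * P t (g i) x)"
    using T(1) by (simp add: AE_ball_countable)
  then show ?thesis
    using AE_space
  proof eventually_elim
    case (elim x)
    have "closed {c. 0 \<le> (\<Sum>i<n. c i * P t (g i) x)}"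
      by (intro closed_Collect_le continuous_intros continuous_on_product_coordinates)
    then have "closure T \<subseteq> {c. 0 \<le> (\<Sum>i<n. c i * P t (g i) x)}"
      using elim by (intro closure_minimal) auto
    moreover have "(\<lambda>i. h i x) \<in> S"
      using nonneg elim by (auto simp: S_def)
    ultimately show ?case
      using T(3) by auto
  qed
qed

text \<open>
  The truncated functions converge in \<open>L\<^sup>q\<close> and \<open>P t\<close> is a contraction there, so the first factor
  converges in \<open>L\<^sup>q\<close>; the second is dominated by \<open>f\<close>.
\<close>

lemma pairing_truncation_limit:
  assumes t: "0 \<le> t" and q: "1 < q"
    and f: "f \<in> Lp_space m (q / (q - 1))" and g: "g \<in> Lp_space m q"
    and B: "\<And>n. B n \<in> sets m" "incseq B" "(\<Union>n. B n) = space m"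
  shows "(\<lambda>n. pairing m (P t (\<lambda>x. indicator (B n) x * g x)) (\<lambda>x. indicator (B n) x * f x))
    \<longlonglongrightarrow> pairing m (P t g) f"
proof -
  define q' where "q' = q / (q - 1)"
  define I where "I n = (indicator (B n) :: 'a \<Rightarrow> real)" for n
  have [measurable]: "f \<in> borel_measurable m" "g \<in> borel_measurable m" "B n \<in> sets m"
      "I n \<in> borel_measurable m" for n
    using f g B by (simp_all add: Lp_space_def I_def)
  have I01: "0 \<le> I n x" "I n x \<le> 1" for n x
    by (simp_all add: I_def split: split_indicator)
  have I_lim: "(\<lambda>n. I n x) \<longlonglongrightarrow> 1" if "x \<in> space m" for x
    using tendsto_mult_indicator[OF B(2,3) that] unfolding I_def
    by (rule tendsto_eventually)
  have Ig: "(\<lambda>x. I n x * g x) \<in> Lp_space m q" for n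
    by (rule Lp_space_dominated[OF g])
       (use q I01 in \<open>auto simp: abs_mult mult_left_le_one_le\<close>)
  have If: "(\<lambda>x. I n x * f x) \<in> Lp_space m q'" for n
    unfolding q'_def by (rule Lp_space_dominated[OF f])
       (use q I01 in \<open>auto simp: abs_mult mult_left_le_one_le\<close>)
  have Pg: "P t g \<in> Lp_space m q" "P t (\<lambda>x. I n x * g x) \<in> Lp_space m q" for n
    using t q g Ig by (auto intro!: P_Lp)
  have [measurable]: "P t g \<in> borel_measurable m" "P t (\<lambda>x. I n x * g x) \<in> borel_measurable m" for n
    using Pg by (auto simp: Lp_space_def)
  define d where "d n x = P t (\<lambda>x. I n x * g x) x - P t g x" for n x
  have d: "d n \<in> Lp_space m q" for n
    unfolding d_def using Pg q by (intro Lp_space_diff) auto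
  have d_lim: "(\<lambda>n. \<integral>x. \<bar>d n x\<bar> powr q \<partial>m) \<longlonglongrightarrow> 0"
  proof (rule tendsto_sandwich)
    show "eventually (\<lambda>n. 0 \<le> (\<integral>x. \<bar>d n x\<bar> powr q \<partial>m)) sequentially"
      by simp
    show "eventually (\<lambda>n. (\<integral>x. \<bar>d n x\<bar> powr q \<partial>m) \<le> (\<integral>x. \<bar>I n x * g x - g x\<bar> powr q \<partial>m)) sequentially"
    proof (intro always_eventually allI)
      fix n
      have diff: "(\<lambda>x. I n x * g x - g x) \<in> Lp_space m q"
        using Ig g q by (intro Lp_space_diff) auto
      have [measurable]: "P t (\<lambda>x. I n x * g x - g x) \<in> borel_measurable m"
        using P_Lp[OF _ t diff] q by (simp add: Lp_space_def)
      have "(\<integral>x. \<bar>d n x\<bar> powr q \<partial>m) = (\<integral>x. \<bar>P t (\<lambda>x. I n x * g x - g x) x\<bar> powr q \<partial>m)"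
      proof (rule integral_cong_AE)
        show "AE x in m. \<bar>d n x\<bar> powr q = \<bar>P t (\<lambda>x. I n x * g x - g x) x\<bar> powr q"
          using P_diff[OF less_imp_le[OF q] t Ig g, of n] by eventually_elim (simp add: d_def)
      qed (simp_all add: d_def)
      also have "\<dots> \<le> (\<integral>x. \<bar>I n x * g x - g x\<bar> powr q \<partial>m)"
        using diff t q by (intro P_contraction) auto
      finally show "(\<integral>x. \<bar>d n x\<bar> powr q \<partial>m) \<le> (\<integral>x. \<bar>I n x * g x - g x\<bar> powr q \<partial>m)" .
    qed
    have "(\<lambda>n. \<integral>x. \<bar>I n x * g x - g x\<bar> powr q \<partial>m) \<longlonglongrightarrow> (\<integral>x. 0 \<partial>m)"
    proof (rule integral_dominated_convergence[where w = "\<lambda>x. \<bar>g x\<bar> powr q"])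
      show "AE x in m. (\<lambda>n. \<bar>I n x * g x - g x\<bar> powr q) \<longlonglongrightarrow> 0"
      proof (rule AE_I2)
        fix x assume "x \<in> space m"
        have "(\<lambda>n. \<bar>I n x * g x - g x\<bar> powr q) \<longlonglongrightarrow> \<bar>1 * g x - g x\<bar> powr q"
          using q I_lim[OF \<open>x \<in> space m\<close>] by (intro tendsto_intros tendsto_powr') auto
        then show "(\<lambda>n. \<bar>I n x * g x - g x\<bar> powr q) \<longlonglongrightarrow> 0"
          by simp
      qed
      show "AE x in m. norm (\<bar>I n x * g x - g x\<bar> powr q) \<le> \<bar>g x\<bar> powr q" for n
        using q by (auto simp: I_def split: split_indicator)
    qed (use g in \<open>auto simp: Lp_space_def\<close>)
    then show "(\<lambda>n. \<integral>x. \<bar>I n x * g x - g x\<bar> powr q \<partial>m) \<longlonglongrightarrow> 0"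
      by simp
  qed simp
  have int_df: "integrable m (\<lambda>x. d n x * (I n x * f x))" for n
    using integrable_mult_Lp[OF q If[unfolded q'_def] d] .
  have df_lim: "(\<lambda>n. \<integral>x. d n x * (I n x * f x) \<partial>m) \<longlonglongrightarrow> 0"
  proof (rule LIMSEQ_I)
    fix r :: real assume r: "0 < r"
    define K where "K = (\<integral>x. \<bar>f x\<bar> powr q' \<partial>m) + 1"
    have K: "0 < K"
      by (simp add: K_def add_nonneg_pos)
    \<comment> \<open>Chosen so that the first term of \<open>young_parameter\<close> integrates to at most \<open>r / 2\<close>.\<close>
    define \<eta> where "\<eta> = (r / (2 * K)) powr (1 / q')"
    have q': "0 < q'" using q by (simp add: q'_def)
    have \<eta>: "0 < \<eta>" "\<eta> powr q' = r / (2 * K)"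
      using r K q' by (simp_all add: \<eta>_def powr_powr)
    have "eventually (\<lambda>n. (\<integral>x. \<bar>d n x\<bar> powr q \<partial>m) < r / (2 * \<eta> powr - q)) sequentially"
      using r \<eta>(1) by (intro order_tendstoD(2)[OF d_lim]) auto
    then obtain N where N: "\<And>n. N \<le> n \<Longrightarrow> (\<integral>x. \<bar>d n x\<bar> powr q \<partial>m) < r / (2 * \<eta> powr - q)"
      by (auto simp: eventually_sequentially)
    show "\<exists>N. \<forall>n\<ge>N. norm ((\<integral>x. d n x * (I n x * f x) \<partial>m) - 0) < r"
    proof (intro exI allI impI)
      fix n assume n: "N \<le> n"
      have "norm (\<integral>x. d n x * (I n x * f x) \<partial>m) \<le> (\<integral>x. norm (d n x * (I n x * f x)) \<partial>m)"
        by (rule integral_norm_bound)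
      also have "\<dots> \<le> (\<integral>x. \<eta> powr q' * \<bar>f x\<bar> powr q' + \<eta> powr - q * \<bar>d n x\<bar> powr q \<partial>m)"
      proof (rule integral_mono)
        show "norm (d n x * (I n x * f x)) \<le> \<eta> powr q' * \<bar>f x\<bar> powr q' + \<eta> powr - q * \<bar>d n x\<bar> powr q" for x
        proof -
          have "norm (d n x * (I n x * f x)) \<le> \<bar>f x * d n x\<bar>"
            by (simp add: I_def abs_mult split: split_indicator)
          also have "\<dots> \<le> \<eta> powr q' * \<bar>f x\<bar> powr q' + \<eta> powr - q * \<bar>d n x\<bar> powr q"
            unfolding q'_def by (rule young_parameter[OF q \<eta>(1)])
          finally show ?thesis .
        qed
      qed (use int_df f d in \<open>auto simp: Lp_space_def q'_def\<close>)
      also have "\<dots> = \<eta> powr q' * (\<integral>x. \<bar>f x\<bar> powr q' \<partial>m) + \<eta> powr - q * (\<integral>x. \<bar>d n x\<bar> powr q \<partial>m)"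
        using f d by (subst Bochner_Integration.integral_add) (auto simp: Lp_space_def q'_def)
      also have "\<dots> < r / 2 + r / 2"
      proof (rule add_le_less_mono)
        have "\<eta> powr q' * (\<integral>x. \<bar>f x\<bar> powr q' \<partial>m) \<le> \<eta> powr q' * K"
          by (intro mult_left_mono) (auto simp: K_def)
        then show "\<eta> powr q' * (\<integral>x. \<bar>f x\<bar> powr q' \<partial>m) \<le> r / 2"
          using K by (simp add: \<eta>(2))
        show "\<eta> powr - q * (\<integral>x. \<bar>d n x\<bar> powr q \<partial>m) < r / 2"
          using N[OF n] \<eta>(1) by (simp add: pos_less_divide_eq mult_ac)
      qed
      finally show "norm ((\<integral>x. d n x * (I n x * f x) \<partial>m) - 0) < r" by simp
    qed
  qed
  have int_Pf: "integrable m (\<lambda>x. P t g x * f x)"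
    using integrable_mult_Lp[OF q f Pg(1)] .
  have int_PIf: "integrable m (\<lambda>x. P t g x * (I n x * f x))" for n
    using integrable_mult_Lp[OF q If[unfolded q'_def] Pg(1)] .
  have "(\<lambda>n. \<integral>x. P t g x * (I n x * f x) \<partial>m) \<longlonglongrightarrow> (\<integral>x. P t g x * f x \<partial>m)"
  proof (rule integral_dominated_convergence[where w = "\<lambda>x. \<bar>P t g x * f x\<bar>"])
    show "AE x in m. (\<lambda>n. P t g x * (I n x * f x)) \<longlonglongrightarrow> P t g x * f x"
    proof (rule AE_I2)
      fix x assume "x \<in> space m"
      have "(\<lambda>n. P t g x * (I n x * f x)) \<longlonglongrightarrow> P t g x * (1 * f x)"
        using I_lim[OF \<open>x \<in> space m\<close>] by (intro tendsto_intros)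
      then show "(\<lambda>n. P t g x * (I n x * f x)) \<longlonglongrightarrow> P t g x * f x"
        by simp
    qed
    show "AE x in m. norm (P t g x * (I n x * f x)) \<le> \<bar>P t g x * f x\<bar>" for n
      by (auto simp: I_def abs_mult split: split_indicator)
  qed (use int_Pf in auto)
  from tendsto_add[OF df_lim this]
  have "(\<lambda>n. (\<integral>x. d n x * (I n x * f x) \<partial>m) + (\<integral>x. P t g x * (I n x * f x) \<partial>m))
      \<longlonglongrightarrow> pairing m (P t g) f"
    by (simp add: pairing_def)
  moreover have "(\<integral>x. d n x * (I n x * f x) \<partial>m) + (\<integral>x. P t g x * (I n x * f x) \<partial>m) =
      pairing m (P t (\<lambda>x. indicator (B n) x * g x)) (\<lambda>x. indicator (B n) x * f x)" for n
    unfolding pairing_def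
    by (subst Bochner_Integration.integral_add[symmetric, OF int_df int_PIf])
       (simp add: d_def I_def algebra_simps)
  ultimately show ?thesis
    by simp
qed

end

section \<open>Comparison of quadratic and power functionals\<close>

text \<open>
  For a convex function the difference quotient at \<open>0\<close> is monotone. Here only midpoint convexity is
  at hand, which gives \<open>g (n * h) \<le> n * g h\<close> for \<open>g t = \<phi> 0 - \<phi> t\<close>; because \<open>g\<close> is increasing,
  multiples of \<open>h\<close> approximate every other point well enough, and the quotient tends to its
  supremum.
\<close>

lemma midpoint_convex_difference_quotient_tendsto:
  fixes \<phi> :: "real \<Rightarrow> real"
  assumes convex: "\<And>s r. 0 \<le> s \<Longrightarrow> 0 \<le> r \<Longrightarrow> 2 * \<phi> (s + r) \<le> \<phi> (2 * s) + \<phi> (2 * r)"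
    and antimono: "\<And>s r. 0 \<le> s \<Longrightarrow> s \<le> r \<Longrightarrow> \<phi> r \<le> \<phi> s"
    and bounded: "eventually (\<lambda>t. (\<phi> 0 - \<phi> t) / t \<le> M) (at_right 0)"
  shows "\<exists>l. ((\<lambda>t. (\<phi> 0 - \<phi> t) / t) \<longlongrightarrow> l) (at_right 0)"
proof -
  define g where "g t = \<phi> 0 - \<phi> t" for t
  have mono: "g s \<le> g r" if "0 \<le> s" "s \<le> r" for s r
    using antimono[OF that] by (simp add: g_def)
  have g_mult: "g (real n * h) \<le> real n * g h" if h: "0 \<le> h" for n h
  proof -
    define d where "d k = \<phi> (real k * h) - \<phi> (real (Suc k) * h)" for k
    have "d (Suc k) \<le> d k" for k
    proof -
      have "2 * \<phi> (real k * h / 2 + real (Suc (Suc k)) * h / 2) \<le>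
          \<phi> (2 * (real k * h / 2)) + \<phi> (2 * (real (Suc (Suc k)) * h / 2))"
        using h by (intro convex) auto
      moreover have "real k * h / 2 + real (Suc (Suc k)) * h / 2 = real (Suc k) * h"
        by (simp add: field_simps)
      ultimately show ?thesis
        by (simp add: d_def)
    qed
    then have "d k \<le> d 0" for k
      using lift_Suc_antimono_le[of d 0 k] by simp
    then have "(\<Sum>k<n. d k) \<le> (\<Sum>k<n. d 0)"
      by (intro sum_mono)
    moreover have "(\<Sum>k<n. d k) = \<phi> 0 - \<phi> (real n * h)"
      using sum_lessThan_telescope'[of "\<lambda>k. \<phi> (real k * h)" n] by (simp add: d_def)
    ultimately show ?thesis
      by (simp add: g_def d_def)
  qed
  obtain \<delta> where \<delta>: "0 < \<delta>" "\<And>t. 0 < t \<Longrightarrow> t < \<delta> \<Longrightarrow> g t / t \<le> M"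
    using bounded unfolding eventually_at_right_field g_def by (metis zero_less_one)
  have le_M: "g t / t \<le> M" if t: "0 < t" for t
  proof -
    obtain n where n: "t / \<delta> < real n"
      using reals_Archimedean2 by blast
    with t \<delta>(1) have n0: "0 < real n"
      by (metis divide_pos_pos order.strict_trans)
    define h where "h = t / real n"
    have h: "0 < h" "h < \<delta>" "real n * h = t"
      using n n0 t \<delta>(1) by (auto simp: h_def field_simps)
    have "g t / t \<le> real n * g h / (real n * h)"
      using g_mult[of h n] h t by (simp add: divide_right_mono)
    also have "\<dots> = g h / h"
      using n0 by simp
    also have "\<dots> \<le> M"
      using h by (intro \<delta>)
    finally show ?thesis .
  qed
  define L where "L = (SUP t\<in>{0<..}. g t / t)"
  have bdd: "bdd_above ((\<lambda>t. g t / t) ` {0<..})"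
    using le_M by (intro bdd_aboveI2[where M = M]) auto
  have upper: "g t / t \<le> L" if "0 < t" for t
    unfolding L_def using that bdd by (intro cSUP_upper) auto
  have "((\<lambda>t. g t / t) \<longlongrightarrow> L) (at_right 0)"
  proof (rule order_tendstoI)
    fix a assume "L < a"
    then show "eventually (\<lambda>t. g t / t < a) (at_right 0)"
      unfolding eventually_at_right_field using upper by (intro exI[of _ 1]) (auto intro: le_less_trans)
  next
    fix a assume "a < L"
    then obtain s where s: "0 < s" "a < g s / s"
      unfolding L_def using less_cSUP_iff[OF _ bdd] by auto
    have "((\<lambda>h. g s / (s + h)) \<longlongrightarrow> g s / (s + 0)) (at_right 0)"
      using s by (intro tendsto_intros) auto
    then have "eventually (\<lambda>h. a < g s / (s + h)) (at_right 0)"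
      using s by (intro order_tendstoD) auto
    moreover have "eventually (\<lambda>h. 0 < h) (at_right (0::real))"
      by (simp add: eventually_at_right_less)
    ultimately show "eventually (\<lambda>h. a < g h / h) (at_right 0)"
    proof eventually_elim
      case (elim h)
      define n where "n = nat \<lceil>s / h\<rceil>"
      have n: "s / h \<le> real n" "real n \<le> s / h + 1"
        using s elim by (auto simp: n_def intro: real_nat_ceiling_ge)
      then have nh: "s \<le> real n * h" "real n * h \<le> s + h"
        using elim by (auto simp: field_simps)
      have n0: "0 < real n"
        using nh s elim by (cases "n = 0") auto
      have gs: "0 \<le> g s"
        using mono[of 0 s] s by (simp add: g_def)
      have "a < g s / (s + h)"
        by fact
      also have "\<dots> \<le> g s / (real n * h)"
        using gs nh s elim n0 by (intro divide_left_mono) auto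
      also have "\<dots> \<le> g (real n * h) / (real n * h)"
        using nh s elim n0 by (intro divide_right_mono mono) auto
      also have "\<dots> \<le> real n * g h / (real n * h)"
        using elim n0 by (intro divide_right_mono g_mult) auto
      also have "\<dots> = g h / h"
        using n0 by simp
      finally show ?case .
    qed
  qed
  then show ?thesis
    by (auto simp: g_def)
qed

lemma indicator_Lp:
  assumes "A \<in> sets m" "emeasure m A \<noteq> \<infinity>"
  shows "(\<lambda>x. indicator A x) \<in> Lp_space m q"
proof -
  have "(\<lambda>x. \<bar>indicator A x\<bar> powr q) = (indicator A :: _ \<Rightarrow> real)"
    by (auto simp: fun_eq_iff split: split_indicator)
  then show ?thesis
    using assms by (simp add: Lp_space_def less_top)
qed

lemma bounded_support_Lp:
  assumes "A \<in> sets m" "emeasure m A \<noteq> \<infinity>" "0 \<le> q" "g \<in> borel_measurable m"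
    and "\<And>x. x \<in> space m \<Longrightarrow> \<bar>g x\<bar> \<le> C * indicator A x"
  shows "g \<in> Lp_space m q"
  by (rule Lp_space_dominated[OF Lp_space_scale[OF indicator_Lp[OF assms(1,2)], of C] assms(4,3)])
     (use assms(5) in fastforce)

lemma signed_powr_Lp:
  assumes "u \<in> Lp_space m p"
  shows "(\<lambda>x. signed_powr (u x) (p / 2)) \<in> Lp_space m 2"
    and "1 < p \<Longrightarrow> (\<lambda>x. signed_powr (u x) (p - 1)) \<in> Lp_space m (p / (p - 1))"
proof -
  have [measurable]: "u \<in> borel_measurable m"
    using assms by (simp add: Lp_space_def)
  show "(\<lambda>x. signed_powr (u x) (p / 2)) \<in> Lp_space m 2"
    using assms by (simp add: Lp_space_2 signed_powr_half_square Lp_space_integrable)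
  show "(\<lambda>x. signed_powr (u x) (p - 1)) \<in> Lp_space m (p / (p - 1))" if "1 < p"
    using assms that by (simp add: Lp_space_def abs_signed_powr powr_powr)
qed

context markovian_semigroup begin

text \<open>
  An inequality between functions of two points is turned into one between pairings with \<open>P t\<close> by
  \<open>P_tensor_pos\<close>. The functions involved lie in different Lebesgue spaces (and the constant \<open>1\<close> in
  none with finite exponent), whereas linearity of \<open>P t\<close> is available in one space at a time.
  Multiplying everything by the indicator of a set \<open>B\<close> of finite measure on which \<open>u\<close> is bounded
  puts all of them into \<open>L\<^sup>2\<close>, with \<open>indicator B\<close> in the role of the constant. The \<open>\<alpha>\<close> term is
  then estimated by contractivity on \<open>L\<^sup>1\<close> and the \<open>\<beta>\<close> term by \<open>P t (indicator B) \<le> 1\<close>,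
  both coefficients being nonnegative.
\<close>

lemma truncated_powr_comparison:
  fixes f :: "nat \<Rightarrow> 'a \<Rightarrow> real" and c :: "nat \<Rightarrow> nat \<Rightarrow> real"
  assumes t: "0 \<le> t" and p: "1 < p" and u: "u \<in> Lp_space m p"
    and \<alpha>: "0 \<le> \<alpha>" and \<beta>: "0 \<le> \<beta>"
    and f: "\<And>i. i < n \<Longrightarrow> f i \<in> Lp_space m 2"
    and f_bounded: "\<And>i. i < n \<Longrightarrow> \<exists>C. \<forall>x\<in>space m. \<bar>f i x\<bar> \<le> C"
    and B: "B \<in> sets m" "emeasure m B \<noteq> \<infinity>" "\<And>x. x \<in> B \<Longrightarrow> \<bar>u x\<bar> \<le> K"
    and le: "\<And>x y. x \<in> space m \<Longrightarrow> y \<in> space m \<Longrightarrow> (\<Sum>j<n. \<Sum>i<n. c i j * (f i x * f j y)) \<le>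
      \<alpha> * \<bar>u y\<bar> powr p + \<beta> * \<bar>u x\<bar> powr p +
      \<gamma> * (signed_powr (u x) (p / 2) * signed_powr (u y) (p / 2)) +
      \<kappa> * (signed_powr (u x) (p - 1) * u y)"
  defines "T w \<equiv> (\<lambda>x. indicator B x * w x)"
  defines "v \<equiv> (\<lambda>x. signed_powr (u x) (p / 2))"
  defines "z \<equiv> (\<lambda>x. signed_powr (u x) (p - 1))"
  shows "(\<Sum>j<n. \<Sum>i<n. c i j * pairing m (P t (T (f j))) (T (f i))) \<le>
      (\<alpha> + \<beta>) * (\<integral>x. \<bar>u x\<bar> powr p \<partial>m) + \<gamma> * pairing m (P t (T v)) (T v) +
      \<kappa> * pairing m (P t (T u)) (T z)"
proof -
  define w where "w = (\<lambda>x. \<bar>u x\<bar> powr p)"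
  define one :: "'a \<Rightarrow> real" where "one = (\<lambda>x. 1)"
  have [measurable]: "B \<in> sets m" "u \<in> borel_measurable m" "v \<in> borel_measurable m"
      "z \<in> borel_measurable m" "w \<in> borel_measurable m" "one \<in> borel_measurable m"
    using u B by (auto simp: Lp_space_def v_def z_def w_def one_def)
  have f_meas: "f i \<in> borel_measurable m" if "i < n" for i
    using f[OF that] by (simp add: Lp_space_def)
  have T_Lp: "T s \<in> Lp_space m q" if "s \<in> borel_measurable m" "\<And>x. x \<in> B \<Longrightarrow> \<bar>s x\<bar> \<le> C" "1 \<le> q" for s C q
    unfolding T_def
    by (rule bounded_support_Lp[OF B(1,2), of _ _ C]) (use that B in \<open>auto split: split_indicator\<close>)
  have T_bounded: "\<exists>C. \<forall>x\<in>space m. \<bar>T s x\<bar> \<le> C" if "\<And>x. x \<in> B \<Longrightarrow> \<bar>s x\<bar> \<le> C" for s C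
    by (rule exI[of _ "max C 0"]) (use that in \<open>auto simp: T_def le_max_iff_disj split: split_indicator\<close>)
  have bounds: "\<bar>v x\<bar> \<le> K powr (p / 2)" "\<bar>z x\<bar> \<le> K powr (p - 1)" "\<bar>w x\<bar> \<le> K powr p"
    "\<bar>one x\<bar> \<le> 1" if "x \<in> B" for x
    using B(3)[OF that] p by (auto simp: v_def z_def w_def one_def abs_signed_powr intro!: powr_mono2)
  have Tf: "T (f i) \<in> Lp_space m 2" "\<exists>C. \<forall>x\<in>space m. \<bar>T (f i) x\<bar> \<le> C" if "i < n" for i
  proof -
    obtain C where C: "\<forall>x\<in>space m. \<bar>f i x\<bar> \<le> C"
      using f_bounded[OF \<open>i < n\<close>] by blast
    have "\<bar>f i x\<bar> \<le> C" if "x \<in> B" for x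
      using C sets.sets_into_space[OF B(1)] that by blast
    then show "T (f i) \<in> Lp_space m 2" "\<exists>C. \<forall>x\<in>space m. \<bar>T (f i) x\<bar> \<le> C"
      by (rule T_Lp[OF f_meas[OF \<open>i < n\<close>]], simp_all) (rule T_bounded)
  qed
  have TLp: "T u \<in> Lp_space m q" "T v \<in> Lp_space m q" "T z \<in> Lp_space m q" "T w \<in> Lp_space m q"
    "T one \<in> Lp_space m q" if "1 \<le> q" for q
    using that by (auto intro!: T_Lp bounds B(3))
  define g where "g = case_nat (T w) (case_nat (T one) (case_nat (T v) (case_nat (T u) (\<lambda>j. T (f j)))))"
  define h where "h = case_nat (\<lambda>x. \<alpha>) (case_nat (\<lambda>x. \<beta> * T w x) (case_nat (\<lambda>x. \<gamma> * T v x)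
    (case_nat (\<lambda>x. \<kappa> * T z x) (\<lambda>j x. - (\<Sum>i<n. c i j * T (f i) x)))))"
  have sum_hg: "(\<Sum>i<Suc (Suc (Suc (Suc n))). h i x * G (g i)) =
      \<alpha> * G (T w) + \<beta> * T w x * G (T one) + \<gamma> * T v x * G (T v) + \<kappa> * T z x * G (T u) -
      (\<Sum>j<n. \<Sum>i<n. c i j * (T (f i) x * G (T (f j))))" for x and G :: "('a \<Rightarrow> real) \<Rightarrow> real"
    unfolding sum.lessThan_Suc_shift g_def h_def
    by (simp add: sum_negf sum_distrib_right mult.assoc)
  have "AE x in m. 0 \<le> (\<Sum>i<Suc (Suc (Suc (Suc n))). h i x * P t (g i) x)"
  proof (rule P_tensor_pos[OF t])
    show "g i \<in> Lp_space m 2" if "i < Suc (Suc (Suc (Suc n)))" for i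
      using that Tf TLp[of 2] by (auto simp: g_def split: nat.split)
    show "\<exists>C. \<forall>x\<in>space m. \<bar>g i x\<bar> \<le> C" if "i < Suc (Suc (Suc (Suc n)))" for i
      using that Tf T_bounded[OF bounds(1)] T_bounded[OF bounds(3)] T_bounded[OF bounds(4)] T_bounded[OF B(3)]
      by (auto simp: g_def split: nat.split)
    show "0 \<le> (\<Sum>i<Suc (Suc (Suc (Suc n))). h i x * g i y)" if xy: "x \<in> space m" "y \<in> space m" for x y
    proof -
      \<comment> \<open>Outside \<open>B\<close> in either variable at most the \<open>\<alpha>\<close> term survives.\<close>
      have "0 \<le> \<alpha> * T w y + \<beta> * T w x * T one y + \<gamma> * T v x * T v y + \<kappa> * T z x * T u y -
          (\<Sum>j<n. \<Sum>i<n. c i j * (T (f i) x * T (f j) y))"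
      proof (cases "x \<in> B \<and> y \<in> B")
        case True
        then show ?thesis
          using le[OF xy] by (simp add: T_def w_def v_def z_def one_def mult.assoc)
      next
        case False
        then show ?thesis
          using \<alpha> by (auto simp: T_def w_def)
      qed
      then show ?thesis
        using sum_hg[of x "\<lambda>s. s y"] by simp
    qed
  qed
  then have "AE x in m. 0 \<le> \<alpha> * P t (T w) x + \<beta> * T w x * P t (T one) x + \<gamma> * T v x * P t (T v) x +
      \<kappa> * T z x * P t (T u) x - (\<Sum>j<n. \<Sum>i<n. c i j * (T (f i) x * P t (T (f j)) x))"
    by (subst (asm) sum_hg)
  moreover have "AE x in m. 0 \<le> P t (T one) x \<and> P t (T one) x \<le> 1"
    by (rule P_Markov[OF t TLp(5)]) (auto simp: T_def one_def split: split_indicator)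
  ultimately have AE: "AE x in m. 0 \<le> \<alpha> * \<bar>P t (T w) x\<bar> + \<beta> * T w x + \<gamma> * (P t (T v) x * T v x) +
      \<kappa> * (P t (T u) x * T z x) - (\<Sum>j<n. \<Sum>i<n. c i j * (P t (T (f j)) x * T (f i) x))"
  proof eventually_elim
    case (elim x)
    have "\<alpha> * P t (T w) x \<le> \<alpha> * \<bar>P t (T w) x\<bar>"
      using \<alpha> by (intro mult_left_mono) auto
    moreover have "\<beta> * T w x * P t (T one) x \<le> \<beta> * T w x"
      using elim \<beta> by (intro mult_left_le) (auto simp: T_def w_def)
    ultimately show ?case
      using elim by (simp add: mult_ac)
  qed
  have int: "integrable m (\<lambda>x. \<bar>P t (T w) x\<bar>)" "integrable m (T w)"
    "integrable m (\<lambda>x. P t (T v) x * T v x)" "integrable m (\<lambda>x. P t (T u) x * T z x)"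
  proof -
    show "integrable m (\<lambda>x. \<bar>P t (T w) x\<bar>)"
      using P_Lp[OF _ t TLp(4)[of 1]] by (simp add: Lp_space_def)
    show "integrable m (T w)"
      using TLp(4)[of 1] by (simp add: Lp_space_def T_def w_def)
    show "integrable m (\<lambda>x. P t (T v) x * T v x)" "integrable m (\<lambda>x. P t (T u) x * T z x)"
      by (intro integrable_mult_L2 P_Lp[OF _ t] TLp; simp)+
  qed
  have int_f: "integrable m (\<lambda>x. P t (T (f j)) x * T (f i) x)" if "i < n" "j < n" for i j
    using that by (auto intro!: integrable_mult_L2 P_Lp[OF _ t] Tf)
  have int_S: "integrable m (\<lambda>x. \<Sum>j<n. \<Sum>i<n. c i j * (P t (T (f j)) x * T (f i) x))"
    "(\<integral>x. (\<Sum>j<n. \<Sum>i<n. c i j * (P t (T (f j)) x * T (f i) x)) \<partial>m) =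
      (\<Sum>j<n. \<Sum>i<n. c i j * (\<integral>x. P t (T (f j)) x * T (f i) x \<partial>m))"
  proof -
    have "has_bochner_integral m (\<lambda>x. \<Sum>j<n. \<Sum>i<n. c i j * (P t (T (f j)) x * T (f i) x))
        (\<Sum>j<n. \<Sum>i<n. c i j * (\<integral>x. P t (T (f j)) x * T (f i) x \<partial>m))"
      by (intro has_bochner_integral_sum has_bochner_integral_mult_right has_bochner_integral_integrable int_f)
         auto
    then show "integrable m (\<lambda>x. \<Sum>j<n. \<Sum>i<n. c i j * (P t (T (f j)) x * T (f i) x))"
      "(\<integral>x. (\<Sum>j<n. \<Sum>i<n. c i j * (P t (T (f j)) x * T (f i) x)) \<partial>m) =
        (\<Sum>j<n. \<Sum>i<n. c i j * (\<integral>x. P t (T (f j)) x * T (f i) x \<partial>m))"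
      by (auto simp: has_bochner_integral_iff)
  qed
  have "0 \<le> (\<integral>x. \<alpha> * \<bar>P t (T w) x\<bar> + \<beta> * T w x + \<gamma> * (P t (T v) x * T v x) +
      \<kappa> * (P t (T u) x * T z x) - (\<Sum>j<n. \<Sum>i<n. c i j * (P t (T (f j)) x * T (f i) x)) \<partial>m)"
    by (rule integral_nonneg_AE[OF AE])
  also have "\<dots> = \<alpha> * (\<integral>x. \<bar>P t (T w) x\<bar> \<partial>m) + \<beta> * (\<integral>x. T w x \<partial>m) +
      \<gamma> * pairing m (P t (T v)) (T v) + \<kappa> * pairing m (P t (T u)) (T z) -
      (\<Sum>j<n. \<Sum>i<n. c i j * pairing m (P t (T (f j))) (T (f i)))"
    using int int_S by (simp add: pairing_def)
  also have "\<dots> \<le> \<alpha> * (\<integral>x. \<bar>u x\<bar> powr p \<partial>m) + \<beta> * (\<integral>x. \<bar>u x\<bar> powr p \<partial>m) +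
      \<gamma> * pairing m (P t (T v)) (T v) + \<kappa> * pairing m (P t (T u)) (T z) -
      (\<Sum>j<n. \<Sum>i<n. c i j * pairing m (P t (T (f j))) (T (f i)))"
  proof -
    have Tw: "(\<integral>x. T w x \<partial>m) \<le> (\<integral>x. \<bar>u x\<bar> powr p \<partial>m)"
      using u int(2) by (intro integral_mono) (auto simp: T_def w_def Lp_space_def split: split_indicator)
    have "(\<integral>x. \<bar>P t (T w) x\<bar> \<partial>m) \<le> (\<integral>x. \<bar>T w x\<bar> \<partial>m)"
      using P_contraction[OF _ t TLp(4)[of 1]] by simp
    also have "\<dots> = (\<integral>x. T w x \<partial>m)"
      by (simp add: T_def w_def)
    finally have "(\<integral>x. \<bar>P t (T w) x\<bar> \<partial>m) \<le> (\<integral>x. \<bar>u x\<bar> powr p \<partial>m)"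
      using Tw by linarith
    then have "\<alpha> * (\<integral>x. \<bar>P t (T w) x\<bar> \<partial>m) \<le> \<alpha> * (\<integral>x. \<bar>u x\<bar> powr p \<partial>m)"
      using \<alpha> by (rule mult_left_mono)
    moreover have "\<beta> * (\<integral>x. T w x \<partial>m) \<le> \<beta> * (\<integral>x. \<bar>u x\<bar> powr p \<partial>m)"
      using Tw \<beta> by (rule mult_left_mono)
    ultimately show ?thesis
      by linarith
  qed
  finally show ?thesis
    by (simp add: distrib_right)
qed

text \<open>
  The main tool, obtained by letting \<open>B\<close> increase to the whole space. The right-hand side of the
  hypothesis vanishes for \<open>x = y\<close> because the coefficients add up to \<open>0\<close>; for the same reason the
  integrals of \<open>\<bar>u\<bar> powr p\<close> combine with the pairings into difference quotients. It is used with
  \<open>F\<^sub>p\<close>, with \<open>F\<^sub>p\<close> minus a small multiple of the squared difference of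
  \<open>signed_powr u (p / 2)\<close>, and with a large multiple of that square minus \<open>F\<^sub>p\<close>.
\<close>

lemma powr_comparison:
  fixes f :: "nat \<Rightarrow> 'a \<Rightarrow> real" and c :: "nat \<Rightarrow> nat \<Rightarrow> real"
  assumes t: "0 < t" and p: "1 < p" and u: "u \<in> Lp_space m p"
    and coeffs: "0 \<le> \<alpha>" "0 \<le> \<beta>" "\<alpha> + \<beta> + \<gamma> + \<kappa> = 0"
    and f: "\<And>i. i < n \<Longrightarrow> f i \<in> Lp_space m 2"
    and f_bounded: "\<And>i. i < n \<Longrightarrow> \<exists>C. \<forall>x\<in>space m. \<bar>f i x\<bar> \<le> C"
    and le: "\<And>x y. x \<in> space m \<Longrightarrow> y \<in> space m \<Longrightarrow> (\<Sum>j<n. \<Sum>i<n. c i j * (f i x * f j y)) \<le>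
      \<alpha> * \<bar>u y\<bar> powr p + \<beta> * \<bar>u x\<bar> powr p +
      \<gamma> * (signed_powr (u x) (p / 2) * signed_powr (u y) (p / 2)) +
      \<kappa> * (signed_powr (u x) (p - 1) * u y)"
  defines "v \<equiv> (\<lambda>x. signed_powr (u x) (p / 2))"
  defines "z \<equiv> (\<lambda>x. signed_powr (u x) (p - 1))"
  shows "(\<Sum>j<n. \<Sum>i<n. c i j * (pairing m (P t (f j)) (f i) / t)) \<le>
      - \<gamma> * approx_form m P t v v - \<kappa> * approx_form m P t u z"
proof -
  have [measurable]: "u \<in> borel_measurable m"
    using u by (simp add: Lp_space_def)
  have v: "v \<in> Lp_space m 2" and z: "z \<in> Lp_space m (p / (p - 1))"
    unfolding v_def z_def using signed_powr_Lp[OF u] p by auto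
  obtain A where A: "range A \<subseteq> sets m" "(\<Union>i. A i) = space m" "\<And>i. emeasure m (A i) \<noteq> \<infinity>" "incseq A"
    using sigma_finite_incseq by blast
  define B where "B k = A k \<inter> {x \<in> space m. \<bar>u x\<bar> \<le> real k}" for k
  have B_sets: "B k \<in> sets m" for k
    using A(1) by (auto simp: B_def)
  have B_finite: "emeasure m (B k) \<noteq> \<infinity>" for k
  proof -
    have "emeasure m (B k) \<le> emeasure m (A k)"
      using A(1) by (intro emeasure_mono) (auto simp: B_def)
    then show ?thesis
      using A(3)[of k] by (auto simp: top_unique)
  qed
  have B_inc: "incseq B"
    using incseqD[OF A(4)] by (auto simp: incseq_def B_def intro: order_trans)
  have B_Un: "(\<Union>k. B k) = space m"
  proof (intro equalityI subsetI)
    fix x assume x: "x \<in> space m"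
    then obtain i where i: "x \<in> A i" using A(2) by blast
    obtain j where j: "\<bar>u x\<bar> \<le> real j" using real_arch_simple by blast
    have "x \<in> B (max i j)"
      using x j incseqD[OF A(4), of i "max i j"] i by (auto simp: B_def)
    then show "x \<in> (\<Union>k. B k)" by blast
  qed (auto simp: B_def)
  define T where "T k w = (\<lambda>x. indicator (B k) x * w x :: real)" for k w
  note limit = pairing_truncation_limit[OF less_imp_le[OF t] _ _ _ B_sets B_inc B_Un, folded T_def]
  have "(\<Sum>j<n. \<Sum>i<n. c i j * pairing m (P t (f j)) (f i)) \<le>
      (\<alpha> + \<beta>) * (\<integral>x. \<bar>u x\<bar> powr p \<partial>m) + \<gamma> * pairing m (P t v) v + \<kappa> * pairing m (P t u) z"
  proof (rule LIMSEQ_le)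
    show "(\<lambda>k. \<Sum>j<n. \<Sum>i<n. c i j * pairing m (P t (T k (f j))) (T k (f i))) \<longlonglongrightarrow>
        (\<Sum>j<n. \<Sum>i<n. c i j * pairing m (P t (f j)) (f i))"
      using f by (intro tendsto_intros limit[of 2]) auto
    show "(\<lambda>k. (\<alpha> + \<beta>) * (\<integral>x. \<bar>u x\<bar> powr p \<partial>m) + \<gamma> * pairing m (P t (T k v)) (T k v) +
        \<kappa> * pairing m (P t (T k u)) (T k z)) \<longlonglongrightarrow>
        (\<alpha> + \<beta>) * (\<integral>x. \<bar>u x\<bar> powr p \<partial>m) + \<gamma> * pairing m (P t v) v + \<kappa> * pairing m (P t u) z"
      using v u z p by (intro tendsto_intros limit[of 2] limit[of p]) auto
    show "\<exists>N. \<forall>k\<ge>N. (\<Sum>j<n. \<Sum>i<n. c i j * pairing m (P t (T k (f j))) (T k (f i))) \<le>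
        (\<alpha> + \<beta>) * (\<integral>x. \<bar>u x\<bar> powr p \<partial>m) + \<gamma> * pairing m (P t (T k v)) (T k v) +
        \<kappa> * pairing m (P t (T k u)) (T k z)"
      unfolding T_def v_def z_def
      by (intro exI[of _ 0] allI impI truncated_powr_comparison less_imp_le[OF t] p u coeffs f
          f_bounded B_sets B_finite le) (auto simp: B_def)
  qed
  then have "(\<Sum>j<n. \<Sum>i<n. c i j * pairing m (P t (f j)) (f i)) / t \<le>
      ((\<alpha> + \<beta>) * (\<integral>x. \<bar>u x\<bar> powr p \<partial>m) + \<gamma> * pairing m (P t v) v + \<kappa> * pairing m (P t u) z) / t"
    using t by (intro divide_right_mono) auto
  also have "\<dots> = - \<gamma> * (((\<integral>x. \<bar>u x\<bar> powr p \<partial>m) - pairing m (P t v) v) / t)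
      - \<kappa> * (((\<integral>x. \<bar>u x\<bar> powr p \<partial>m) - pairing m (P t u) z) / t)"
  proof -
    have "\<alpha> + \<beta> = - \<gamma> - \<kappa>" using coeffs by simp
    then show ?thesis
      using t by (simp only:) (simp add: field_simps)
  qed
  also have "((\<integral>x. \<bar>u x\<bar> powr p \<partial>m) - pairing m (P t v) v) / t = approx_form m P t v v"
  proof -
    have "pairing m (\<lambda>x. v x - P t v x) v = (\<integral>x. v x * v x - P t v x * v x \<partial>m)"
      by (simp add: pairing_def left_diff_distrib)
    also have "\<dots> = (\<integral>x. v x * v x \<partial>m) - pairing m (P t v) v"
      unfolding pairing_def using v t
      by (intro Bochner_Integration.integral_diff integrable_mult_L2 P_Lp) auto
    also have "(\<integral>x. v x * v x \<partial>m) = (\<integral>x. \<bar>u x\<bar> powr p \<partial>m)"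
      by (simp add: v_def signed_powr_half_square flip: power2_eq_square)
    finally show ?thesis
      by (simp add: approx_form_def)
  qed
  also have "((\<integral>x. \<bar>u x\<bar> powr p \<partial>m) - pairing m (P t u) z) / t = approx_form m P t u z"
  proof -
    have "pairing m (\<lambda>x. u x - P t u x) z = (\<integral>x. u x * z x - P t u x * z x \<partial>m)"
      by (simp add: pairing_def left_diff_distrib)
    also have "\<dots> = (\<integral>x. u x * z x \<partial>m) - pairing m (P t u) z"
      unfolding pairing_def using u z p t
      by (intro Bochner_Integration.integral_diff integrable_mult_Lp[of p] P_Lp) auto
    also have "(\<integral>x. u x * z x \<partial>m) = (\<integral>x. \<bar>u x\<bar> powr p \<partial>m)"
      by (simp add: z_def mult.commute[of "u _"] signed_powr_mult_self)
    finally show ?thesis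
      by (simp add: approx_form_def)
  qed
  finally show ?thesis
    by (simp add: sum_divide_distrib)
qed

lemma P_semigroup:
  "1 \<le> q \<Longrightarrow> 0 \<le> s \<Longrightarrow> 0 \<le> t \<Longrightarrow> u \<in> Lp_space m q \<Longrightarrow> AE x in m. P (s + t) u x = P s (P t u) x"
  using contraction_semigroup by (simp add: contraction_semigroup_def)

lemma P_symmetric:
  "0 \<le> t \<Longrightarrow> u \<in> Lp_space m 2 \<Longrightarrow> v \<in> Lp_space m 2 \<Longrightarrow> pairing m (P t u) v = pairing m u (P t v)"
  using symmetric_markovian by (simp add: symmetric_markovian_def)

lemma pairing_P_add:
  assumes v: "v \<in> Lp_space m 2" and "0 \<le> s" "0 \<le> t"
  shows "pairing m (P (s + t) v) v = (\<integral>x. P t v x * P s v x \<partial>m)"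
proof -
  have Pv: "P r v \<in> Lp_space m 2" if "0 \<le> r" for r
    using v that by (intro P_Lp) auto
  have PPv: "P s (P t v) \<in> Lp_space m 2"
    using Pv assms by (intro P_Lp) auto
  have [measurable]: "P (s + t) v \<in> borel_measurable m" "P s (P t v) \<in> borel_measurable m"
      "v \<in> borel_measurable m"
    using Pv[of "s + t"] PPv v assms by (auto simp: Lp_space_def)
  have "pairing m (P (s + t) v) v = pairing m (P s (P t v)) v"
    unfolding pairing_def using P_semigroup[OF _ assms(2,3) v]
    by (intro integral_cong_AE) auto
  also have "\<dots> = pairing m (P t v) (P s v)"
    using assms Pv by (intro P_symmetric) auto
  finally show ?thesis
    by (simp add: pairing_def)
qed

text \<open>
  By symmetry and the semigroup law \<open>\<phi> t = pairing m (P t v) v\<close> satisfies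
  \<open>\<phi> (s + r) = pairing m (P s v) (P r v)\<close>, so that it is midpoint convex, and
  \<open>\<phi> (2 * r)\<close> is the squared norm of \<open>P r v\<close>, so that it is decreasing.
\<close>

lemma approx_form_convergent:
  assumes v: "v \<in> Lp_space m 2"
    and bounded: "eventually (\<lambda>t. approx_form m P t v v \<le> M) (at_right 0)"
  shows "\<exists>l. ((\<lambda>t. approx_form m P t v v) \<longlongrightarrow> l) (at_right 0)"
proof -
  define \<phi> where "\<phi> t = pairing m (P t v) v" for t
  have Pv: "P r v \<in> Lp_space m 2" if "0 \<le> r" for r
    using v that by (intro P_Lp) auto
  have Pv2: "integrable m (\<lambda>x. (P r v x)\<^sup>2)" if "0 \<le> r" for r
    using Pv[OF that] by (simp add: Lp_space_2)
  have \<phi>2: "\<phi> (2 * r) = (\<integral>x. (P r v x)\<^sup>2 \<partial>m)" if "0 \<le> r" for r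
    using pairing_P_add[OF v that that] by (simp add: \<phi>_def power2_eq_square)
  have "2 * \<phi> (s + r) \<le> \<phi> (2 * s) + \<phi> (2 * r)" if sr: "0 \<le> s" "0 \<le> r" for s r
  proof -
    have "2 * \<phi> (s + r) = (\<integral>x. 2 * (P r v x * P s v x) \<partial>m)"
      using pairing_P_add[OF v sr] by (simp add: \<phi>_def)
    also have "\<dots> \<le> (\<integral>x. (P s v x)\<^sup>2 + (P r v x)\<^sup>2 \<partial>m)"
      using sum_squares_bound[of "P s v _" "P r v _"] sr Pv Pv2
      by (intro integral_mono integrable_mult_right integrable_mult_L2 Bochner_Integration.integrable_add) (auto simp: algebra_simps)
    also have "\<dots> = \<phi> (2 * s) + \<phi> (2 * r)"
      using sr by (simp add: \<phi>2 Pv2)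
    finally show ?thesis .
  qed
  moreover have "\<phi> r \<le> \<phi> s" if sr: "0 \<le> s" "s \<le> r" for s r
  proof -
    define a b where "a = s / 2" and "b = (r - s) / 2"
    have ab: "0 \<le> a" "0 \<le> b" "s = 2 * a" "r = 2 * (b + a)"
      using sr by (auto simp: a_def b_def field_simps)
    have PP: "P b (P a v) \<in> Lp_space m 2"
      using ab by (intro P_Lp Pv) auto
    have [measurable]: "P (b + a) v \<in> borel_measurable m" "P b (P a v) \<in> borel_measurable m"
      using Pv[of "b + a"] PP ab by (auto simp: Lp_space_def)
    have "\<phi> r = (\<integral>x. (P (b + a) v x)\<^sup>2 \<partial>m)"
      unfolding ab(4) using ab by (intro \<phi>2) auto
    also have "\<dots> = (\<integral>x. (P b (P a v) x)\<^sup>2 \<partial>m)"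
      using P_semigroup[OF _ ab(2,1) v] by (intro integral_cong_AE) auto
    also have "\<dots> \<le> (\<integral>x. (P a v x)\<^sup>2 \<partial>m)"
      using P_contraction[OF _ ab(2) Pv[OF ab(1)]] by (simp add: powr_2)
    also have "\<dots> = \<phi> s"
      using ab by (simp add: \<phi>2)
    finally show ?thesis .
  qed
  moreover have eq: "approx_form m P t v v = (\<phi> 0 - \<phi> t) / t" if "0 < t" for t
  proof -
    have [measurable]: "P 0 v \<in> borel_measurable m" "v \<in> borel_measurable m"
      using Pv[of 0] v by (auto simp: Lp_space_def)
    have "AE x in m. P 0 v x = v x"
      using contraction_semigroup[of 2] v by (simp add: contraction_semigroup_def)
    then have "(\<integral>x. P 0 v x * v x \<partial>m) = (\<integral>x. v x * v x \<partial>m)"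
      by (intro integral_cong_AE) auto
    moreover have "(\<integral>x. v x * v x - P t v x * v x \<partial>m) = (\<integral>x. v x * v x \<partial>m) - (\<integral>x. P t v x * v x \<partial>m)"
      using that v Pv by (intro Bochner_Integration.integral_diff integrable_mult_L2) auto
    ultimately show ?thesis
      by (simp add: approx_form_def pairing_def \<phi>_def left_diff_distrib)
  qed
  moreover have pos: "eventually (\<lambda>t. 0 < t) (at_right (0::real))"
    by (simp add: eventually_at_right_less)
  have "eventually (\<lambda>t. (\<phi> 0 - \<phi> t) / t \<le> M) (at_right 0)"
    using bounded pos by eventually_elim (simp add: eq)
  ultimately have "\<exists>l. ((\<lambda>t. (\<phi> 0 - \<phi> t) / t) \<longlongrightarrow> l) (at_right 0)"
    by (intro midpoint_convex_difference_quotient_tendsto)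
  then obtain l where l: "((\<lambda>t. (\<phi> 0 - \<phi> t) / t) \<longlongrightarrow> l) (at_right 0)" ..
  have "((\<lambda>t. approx_form m P t v v) \<longlongrightarrow> l) (at_right 0)"
    by (rule Lim_transform_eventually[OF l]) (use pos in \<open>eventually_elim, simp add: eq\<close>)
  then show ?thesis ..
qed

text \<open>
  The lower bound in \<open>bregman_comparison\<close>, integrated by means of \<open>powr_comparison\<close> with no
  minorizing functions (\<open>n = 0\<close>), bounds the approximating forms of \<open>signed_powr u (p / 2)\<close> by
  those that define the \<open>p\<close>-form.
\<close>

lemma signed_powr_half_approx_form_convergent:
  assumes p: "1 < p" and u: "u \<in> p_form_domain m P p"
  defines "v \<equiv> (\<lambda>x. signed_powr (u x) (p / 2))"
  shows "\<exists>l. ((\<lambda>t. approx_form m P t v v) \<longlongrightarrow> l) (at_right 0)"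
proof -
  define z where "z = (\<lambda>x. signed_powr (u x) (p - 1))"
  obtain l where uLp: "u \<in> Lp_space m p"
    and l: "((\<lambda>t. approx_form m P t u z) \<longlongrightarrow> l) (at_right 0)"
    using u by (auto simp: p_form_domain_def z_def)
  define c where "c = min 1 (p - 1) / 2"
  have c: "0 < c" "c \<le> 1" "c \<le> p - 1"
    using p by (auto simp: c_def min_def)
  have comparison: "approx_form m P t v v \<le> p * approx_form m P t u z / (2 * c)" if "0 < t" for t
  proof -
    have "(\<Sum>j<(0::nat). \<Sum>i<(0::nat). 0 * (pairing m (P t (\<lambda>x. 0)) (\<lambda>x. 0) / t)) \<le>
        - (2 * c) * approx_form m P t v v - (- p) * approx_form m P t u z"
      unfolding v_def z_def
    proof (rule powr_comparison[OF that p uLp, where \<alpha> = "1 - c" and \<beta> = "p - 1 - c"])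
      show "(\<Sum>j<(0::nat). \<Sum>i<(0::nat). 0 * (0 * 0)) \<le>
          (1 - c) * \<bar>u y\<bar> powr p + (p - 1 - c) * \<bar>u x\<bar> powr p +
          2 * c * (signed_powr (u x) (p / 2) * signed_powr (u y) (p / 2)) +
          - p * (signed_powr (u x) (p - 1) * u y)" for x y
        using bregman_comparison(1)[OF p, of "u y" "u x"]
        by (simp add: bregman_eq c_def[symmetric] power2_diff signed_powr_half_square algebra_simps)
    qed (use c in auto)
    then show ?thesis
      using c by (simp add: pos_le_divide_eq mult_ac)
  qed
  have "eventually (\<lambda>t. p * approx_form m P t u z / (2 * c) < p * l / (2 * c) + 1) (at_right 0)"
    by (rule order_tendstoD(2)[of _ "p * l / (2 * c)"]) (use l c in \<open>auto intro!: tendsto_intros\<close>)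
  moreover have "eventually (\<lambda>t. 0 < t) (at_right (0::real))"
    by (simp add: eventually_at_right_less)
  ultimately have "eventually (\<lambda>t. approx_form m P t v v \<le> p * l / (2 * c) + 1) (at_right 0)"
  proof eventually_elim
    case (elim t)
    then show ?case
      using comparison[of t] by linarith
  qed
  then show ?thesis
    unfolding v_def by (rule approx_form_convergent[OF signed_powr_Lp(1)[OF uLp]])
qed

end

section \<open>Hat functions\<close>

definition ramp :: "real \<Rightarrow> real \<Rightarrow> real" where
  "ramp k s = min (max (s - k) 0) 1"

text \<open>
  The usual piecewise linear hat centred at \<open>k\<close>. Writing it as a difference of ramps makes the sum
  over consecutive centres telescope, and reduces the composition with elements of a form domain to
  truncations.
\<close>

definition hat :: "real \<Rightarrow> real \<Rightarrow> real" where
  "hat k s = ramp (k - 1) s - ramp k s"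

lemma hat_nonneg: "0 \<le> hat k s" and hat_le_1: "hat k s \<le> 1"
  by (auto simp: hat_def ramp_def min_def max_def)

lemma hat_support: "hat k s \<noteq> 0 \<Longrightarrow> \<bar>s - k\<bar> < 1"
  by (auto simp: hat_def ramp_def min_def max_def split: if_splits)

lemma hat_minus: "hat (- k) (- s) = hat k s"
  by (auto simp: hat_def ramp_def min_def max_def)

lemma hat_0: "hat 0 s = 1 - (ramp 0 s + ramp 0 (- s))"
  by (auto simp: hat_def ramp_def min_def max_def)

lemma sum_hat:
  "(\<Sum>i<2 * N + 1. hat (real i - real N) s) = ramp (- real N - 1) s - ramp (real N) s"
proof -
  have "(\<Sum>i<2 * N + 1. hat (real i - real N) s) =
      (\<Sum>i<2 * N + 1. ramp (real i - real N - 1) s - ramp (real (Suc i) - real N - 1) s)"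
    by (simp add: hat_def algebra_simps)
  also have "\<dots> = ramp (real 0 - real N - 1) s - ramp (real (2 * N + 1) - real N - 1) s"
    by (rule sum_lessThan_telescope')
  finally show ?thesis by simp
qed

lemma sum_hat_le_1: "(\<Sum>i<2 * N + 1. hat (real i - real N) s) \<le> 1"
  unfolding sum_hat by (auto simp: ramp_def min_def max_def)

lemma sum_hat_eq_1: "\<bar>s\<bar> \<le> real N \<Longrightarrow> (\<Sum>i<2 * N + 1. hat (real i - real N) s) = 1"
  unfolding sum_hat by (auto simp: ramp_def min_def max_def abs_if split: if_splits)

lemma continuous_on_hat [continuous_intros]:
  "continuous_on S f \<Longrightarrow> continuous_on S (\<lambda>x. hat k (f x))"
  unfolding hat_def ramp_def by (intro continuous_intros)

section \<open>Regular Dirichlet forms\<close>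

locale regular_dirichlet_form =
  fixes m :: "'a::{metric_space, second_countable_topology} measure"
    and D :: "('a \<Rightarrow> real) set"
    and \<E> :: "('a \<Rightarrow> real) \<Rightarrow> ('a \<Rightarrow> real) \<Rightarrow> real"
  assumes locally_compact: "locally compact (UNIV :: 'a set)"
    and sets_m: "sets m = sets borel"
    and dirichlet_form: "dirichlet_form m D \<E>"
    and regular_form: "regular_form m D \<E>"
begin

lemma space_m [simp]: "space m = UNIV"
  using sets_eq_imp_space_eq[OF sets_m] by simp

lemma D_L2: "u \<in> D \<Longrightarrow> u \<in> Lp_space m 2"
  and D_zero: "(\<lambda>x. 0) \<in> D"
  and D_add: "u \<in> D \<Longrightarrow> v \<in> D \<Longrightarrow> (\<lambda>x. u x + v x) \<in> D"
  and D_scale: "u \<in> D \<Longrightarrow> (\<lambda>x. c * u x) \<in> D"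
  and D_unit_contraction: "u \<in> D \<Longrightarrow> (\<lambda>x. min (max (u x) 0) 1) \<in> D"
  and form_scale: "u \<in> D \<Longrightarrow> v \<in> D \<Longrightarrow> \<E> (\<lambda>x. c * u x) v = c * \<E> u v"
proof -
  note conjs = dirichlet_form[unfolded dirichlet_form_def]
  show "u \<in> D \<Longrightarrow> u \<in> Lp_space m 2"
    using conjs[THEN conjunct1] by (rule subsetD)
  show "(\<lambda>x. 0) \<in> D"
    by (rule conjs[THEN conjunct2, THEN conjunct1])
  note conjs3 = conjs[THEN conjunct2, THEN conjunct2]
  show "u \<in> D \<Longrightarrow> v \<in> D \<Longrightarrow> (\<lambda>x. u x + v x) \<in> D"
    using conjs3[THEN conjunct1] by blast
  show "u \<in> D \<Longrightarrow> (\<lambda>x. c * u x) \<in> D"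
    using conjs3[THEN conjunct2, THEN conjunct1] by blast
  note conjs9 = conjs3[THEN conjunct2, THEN conjunct2, THEN conjunct2, THEN conjunct2, THEN conjunct2, THEN conjunct2]
  show "u \<in> D \<Longrightarrow> v \<in> D \<Longrightarrow> \<E> (\<lambda>x. c * u x) v = c * \<E> u v"
    using conjs9[THEN conjunct1] by blast
  note conjs13 = conjs9[THEN conjunct2, THEN conjunct2, THEN conjunct2, THEN conjunct2]
  show "u \<in> D \<Longrightarrow> (\<lambda>x. min (max (u x) 0) 1) \<in> D"
    using bspec[OF conjs13] by (rule conjunct1)
qed

lemma D_diff: "u \<in> D \<Longrightarrow> v \<in> D \<Longrightarrow> (\<lambda>x. u x - v x) \<in> D"
  using D_add[of u "\<lambda>x. - 1 * v x"] D_scale[of v "- 1"] by simp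

lemma D_sum: "(\<And>i. i < n \<Longrightarrow> g i \<in> D) \<Longrightarrow> (\<lambda>x. \<Sum>i<(n::nat). g i x) \<in> D"
  by (induction n) (auto intro: D_zero D_add)

lemma D_truncate:
  assumes u: "u \<in> D" and b: "0 \<le> b"
  shows "(\<lambda>x. min (max (u x) 0) b) \<in> D"
proof (cases "b = 0")
  case True
  then show ?thesis using D_zero by simp
next
  case False
  then have "0 < b" using b by simp
  have "(\<lambda>x. b * min (max (1 / b * u x) 0) 1) \<in> D"
    by (intro D_scale D_unit_contraction u)
  moreover have "b * min (max (1 / b * s) 0) 1 = min (max s 0) b" for s
    using \<open>0 < b\<close> by (auto simp: min_def max_def field_simps)
  ultimately show ?thesis
    by simp
qed

lemma D_ramp:
  assumes "u \<in> D" "0 \<le> k"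
  shows "(\<lambda>x. ramp k (u x)) \<in> D"
proof -
  have "ramp k s = min (max s 0) (k + 1) - min (max s 0) k" for s
    using assms(2) by (auto simp: ramp_def min_def max_def)
  then show ?thesis
    using D_diff[OF D_truncate[OF assms(1), of "k + 1"] D_truncate[OF assms]] assms(2) by simp
qed

text \<open>
  The ramp at a level \<open>k \<ge> 0\<close> is a difference of two truncations, which preserve the domain by the
  Markov property, and negative levels are reflected to positive ones. A hat centred at \<open>0\<close> does not
  vanish at \<open>0\<close>, and is therefore excluded.
\<close>

lemma D_hat:
  assumes u: "u \<in> D" and k: "1 \<le> \<bar>k\<bar>"
  shows "(\<lambda>x. hat k (u x)) \<in> D"
proof (cases "1 \<le> k")
  case True
  then show ?thesis
    unfolding hat_def by (intro D_diff D_ramp u) auto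
next
  case False
  have "(\<lambda>x. hat (- k) (- 1 * u x)) \<in> D"
    unfolding hat_def using False k by (intro D_diff D_ramp D_scale u) auto
  then show ?thesis
    by (simp add: hat_minus)
qed

text \<open>
  A compactly supported bump at \<open>z\<close> is uniformly approximated by a function in the domain; doubling
  and truncating the latter makes it equal to \<open>1\<close> near \<open>z\<close>.
\<close>

lemma local_cutoff:
  "\<exists>g U. open U \<and> z \<in> U \<and> g \<in> D \<and> continuous_on UNIV g \<and> (\<forall>x. 0 \<le> g x \<and> g x \<le> 1) \<and> (\<forall>x\<in>U. g x = 1)"
proof -
  obtain U K where UK: "open U" "compact K" "z \<in> U" "U \<subseteq> K"
    using locally_compact unfolding locally_def by (metis UNIV_I open_UNIV openin_open_eq open_openin topspace_euclidean subtopology_UNIV)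
  obtain r where r: "0 < r" "ball z r \<subseteq> U"
    using UK openE by blast
  define f where "f x = max 0 (1 - dist x z / (r / 2))" for x
  have cont: "continuous_on UNIV f"
    unfolding f_def using r by (intro continuous_intros) auto
  have "{x. f x \<noteq> 0} \<subseteq> cball z (r / 2)"
    using r by (auto simp: f_def dist_commute max_def field_simps split: if_splits)
  then have "closure {x. f x \<noteq> 0} \<subseteq> cball z (r / 2)"
    by (intro closure_minimal) auto
  also have "\<dots> \<subseteq> K"
    using r UK by force
  finally have "compact (closure {x. f x \<noteq> 0})"
    using UK(2) by (metis closed_closure compact_Int_closed inf.absorb_iff2)
  with cont have "f \<in> Cc"
    by (simp add: Cc_def)
  then obtain g where g: "g \<in> D" "g \<in> Cc" "\<And>x. \<bar>f x - g x\<bar> < 1 / 4"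
    using regular_form unfolding regular_form_def by (metis IntE zero_less_divide_1_iff zero_less_numeral)
  have g_cont: "continuous_on UNIV g"
    using g by (simp add: Cc_def)
  define h where "h = (\<lambda>x. min (max (2 * g x) 0) 1)"
  have "h \<in> D" "continuous_on UNIV h" "0 \<le> h x \<and> h x \<le> 1" for x
    unfolding h_def using g g_cont by (auto intro!: D_unit_contraction D_scale continuous_intros)
  moreover have "open {x. 1 / 2 < g x}"
    using g_cont by (intro open_Collect_less continuous_intros) auto
  moreover have "1 / 2 < g z"
  proof -
    have "f z = 1" by (simp add: f_def)
    then show ?thesis
      using g(3)[of z] unfolding abs_less_iff by linarith
  qed
  moreover have "h x = 1" if "1 / 2 < g x" for x
    using that by (simp add: h_def)
  ultimately show ?thesis
    by (intro exI[of _ h] exI[of _ "{x. 1 / 2 < g x}"]) auto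
qed

text \<open>
  By the Lindeloef property countably many of the neighbourhoods in \<open>local_cutoff\<close> cover the space.
\<close>

lemma cutoff_sequence:
  obtains \<rho> :: "nat \<Rightarrow> 'a \<Rightarrow> real"
  where "\<And>n. \<rho> n \<in> D" "\<And>n. continuous_on UNIV (\<rho> n)" "\<And>n x. 0 \<le> \<rho> n x" "\<And>n x. \<rho> n x \<le> 1"
    "\<And>x. eventually (\<lambda>n. \<rho> n x = 1) sequentially"
proof -
  define cutoff where "cutoff U g \<longleftrightarrow> open U \<and> g \<in> D \<and> continuous_on UNIV g \<and>
    (\<forall>x. 0 \<le> g x \<and> g x \<le> 1) \<and> (\<forall>x\<in>U. g x = 1)" for U :: "'a set" and g
  define \<F> where "\<F> = {U. \<exists>g. cutoff U g}"
  have "\<Union>\<F> = UNIV"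
    using local_cutoff by (fastforce simp: \<F>_def cutoff_def)
  moreover have "\<And>S. S \<in> \<F> \<Longrightarrow> openin (top_of_set UNIV) S"
    by (auto simp: \<F>_def cutoff_def)
  ultimately obtain \<F>' where \<F>': "\<F>' \<subseteq> \<F>" "countable \<F>'" "\<Union>\<F>' = UNIV"
    using Lindelof_openin by metis
  then have "\<F>' \<noteq> {}" by auto
  define V where "V = from_nat_into \<F>'"
  have V: "V k \<in> \<F>" "range V = \<F>'" for k
    using \<F>' \<open>\<F>' \<noteq> {}\<close> from_nat_into[of \<F>'] range_from_nat_into[of \<F>'] by (auto simp: V_def)
  have "\<forall>k. \<exists>g. cutoff (V k) g"
    using V(1) by (simp add: \<F>_def)
  then obtain g where g: "\<And>k. cutoff (V k) (g k)"
    by metis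
  define \<rho> where "\<rho> n = (\<lambda>x. min (max (\<Sum>k<n. g k x) 0) 1)" for n
  have "\<rho> n \<in> D" for n
    unfolding \<rho>_def using g by (intro D_unit_contraction D_sum) (simp add: cutoff_def)
  moreover have "continuous_on UNIV (\<rho> n)" for n
    unfolding \<rho>_def using g by (intro continuous_intros) (simp add: cutoff_def)
  moreover have "0 \<le> \<rho> n x" "\<rho> n x \<le> 1" for n x
    by (auto simp: \<rho>_def)
  moreover have "eventually (\<lambda>n. \<rho> n x = 1) sequentially" for x
  proof -
    obtain k where k: "x \<in> V k"
      using \<F>'(3) V(2) by blast
    show ?thesis
      unfolding eventually_sequentially
    proof (intro exI allI impI)
      fix n assume n: "Suc k \<le> n"
      have "1 = g k x"
        using g[of k] k by (simp add: cutoff_def)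
      also have "\<dots> \<le> (\<Sum>k<n. g k x)"
        using n g by (intro member_le_sum) (auto simp: cutoff_def)
      finally show "\<rho> n x = 1"
        by (simp add: \<rho>_def)
    qed
  qed
  ultimately show ?thesis
    by (rule that)
qed

text \<open>
  A cutoff function is square integrable, so it can equal \<open>1\<close> only on a set of finite measure.
\<close>

lemma sigma_finite_measure_m: "sigma_finite_measure m"
proof -
  obtain \<rho> :: "nat \<Rightarrow> 'a \<Rightarrow> real"
    where \<rho>: "\<And>n. \<rho> n \<in> D" "\<And>x. eventually (\<lambda>n. \<rho> n x = 1) sequentially"
    using cutoff_sequence by metis
  define A where "A n = {x. \<rho> n x = 1}" for n
  have [measurable]: "\<rho> n \<in> borel_measurable m" for n
    using D_L2[OF \<rho>(1)] by (simp add: Lp_space_def)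
  have A_sets: "A n \<in> sets m" for n
  proof -
    have "A n = {x \<in> space m. \<rho> n x = 1}"
      by (simp add: A_def)
    also have "\<dots> \<in> sets m" by measurable
    finally show ?thesis .
  qed
  have A_finite: "emeasure m (A n) \<noteq> \<infinity>" for n
  proof -
    have "integrable m (\<lambda>x. (\<rho> n x)\<^sup>2)"
      using D_L2[OF \<rho>(1)] by (simp add: Lp_space_2)
    then have "integrable m (indicator (A n) :: 'a \<Rightarrow> real)"
      by (rule Bochner_Integration.integrable_bound) (auto simp: A_sets A_def split: split_indicator)
    then show ?thesis
      using A_sets[of n] by (simp add: integrable_indicator_iff less_top)
  qed
  have "(\<Union>n. A n) = UNIV"
    using \<rho>(2) unfolding A_def eventually_sequentially by blast
  then show ?thesis
    using A_sets A_finite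
    by (intro sigma_finite_measure.intro exI[of _ "range A"]) auto
qed

text \<open>
  The exceptional open set may be taken empty, because the empty set has capacity \<open>0\<close>.
\<close>

lemma qc_version_continuous:
  assumes u: "u \<in> D" and cont: "continuous_on UNIV u"
  shows "qc_version m D \<E> u u"
proof -
  have "\<E> (\<lambda>x. 0) (\<lambda>x. 0) = 0"
    using form_scale[OF D_zero D_zero, of 0] by simp
  then have "open_capacity m D \<E> {} \<le> ennreal 0"
    unfolding open_capacity_def using D_zero
    by (intro INF_lower2[of "\<lambda>x. 0"]) (auto simp: form1_def pairing_def)
  then have "open_capacity m D \<E> {} < ennreal \<epsilon>" if "0 < \<epsilon>" for \<epsilon>
    using that by (simp add: le_less_trans)
  then have "quasi_continuous m D \<E> u"
    unfolding quasi_continuous_def using cont by (intro allI impI exI[of _ "{}"]) auto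
  then show ?thesis
    using cont by (auto simp: qc_version_def intro: borel_measurable_continuous_onI)
qed

end

section \<open>Pure-jump forms\<close>

locale pure_jump_form = regular_dirichlet_form m D \<E>
  for m :: "'a::{metric_space, second_countable_topology} measure" and D \<E> +
  fixes J :: "('a \<times> 'a) measure"
    and P :: "real \<Rightarrow> ('a \<Rightarrow> real) \<Rightarrow> 'a \<Rightarrow> real"
  assumes sets_J: "sets J = sets (restrict_space borel offdiag)"
    and symmetric_J: "symmetric_measure J"
    and pure_jump: "pure_jump m D \<E> J"
    and form_semigroup: "form_semigroup m D \<E> P"
begin

sublocale markovian_semigroup m P
proof -
  interpret sigma_finite_measure m
    by (rule sigma_finite_measure_m)
  show "markovian_semigroup m P"
    using form_semigroup by unfold_locales (auto simp: form_semigroup_def)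
qed

lemma measurable_J_continuous:
  fixes F :: "'a \<times> 'a \<Rightarrow> real"
  assumes "continuous_on UNIV F"
  shows "F \<in> borel_measurable J"
  unfolding measurable_cong_sets[OF sets_J refl]
  by (intro measurable_restrict_space1 borel_measurable_continuous_onI assms)

lemma measurable_swap_J: "prod.swap \<in> measurable J J"
proof -
  have "(prod.swap :: 'a \<times> 'a \<Rightarrow> _) \<in> borel_measurable borel"
    by (intro borel_measurable_continuous_onI) (auto simp: prod.swap_def intro!: continuous_intros)
  then show ?thesis
    unfolding measurable_cong_sets[OF sets_J sets_J]
    by (rule measurable_restrict_space3) (auto simp: offdiag_def)
qed

lemma distr_swap_J: "distr J J prod.swap = J"
proof (rule measure_eqI)
  fix A assume "A \<in> sets (distr J J prod.swap)"
  then have A: "A \<in> sets J" by simp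
  have space_J: "space J = offdiag"
    using sets_eq_imp_space_eq[OF sets_J] by (simp add: space_restrict_space)
  have "prod.swap -` A \<inter> space J = prod.swap ` A"
    using sets.sets_into_space[OF A] by (force simp: space_J offdiag_def)
  then show "emeasure (distr J J prod.swap) A = emeasure J A"
    using symmetric_J A by (simp add: emeasure_distr[OF measurable_swap_J A] symmetric_measure_def)
qed simp

lemma jump_formula:
  assumes "u \<in> D" "v \<in> D" "continuous_on UNIV u" "continuous_on UNIV v"
  shows "integrable J (\<lambda>(x, y). (u y - u x) * (v y - v x))"
    and "\<E> u v = 1 / 2 * (\<integral>(x, y). (u y - u x) * (v y - v x) \<partial>J)"
  using pure_jump qc_version_continuous[OF assms(1,3)] qc_version_continuous[OF assms(2,4)] assms(1,2)
  unfolding pure_jump_def by blast+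

lemma form_limit:
  "u \<in> D \<Longrightarrow> v \<in> D \<Longrightarrow> ((\<lambda>t. approx_form m P t u v) \<longlongrightarrow> \<E> u v) (at_right 0)"
  using form_semigroup by (simp add: form_semigroup_def associated_def)

lemma in_D_iff:
  "u \<in> D \<longleftrightarrow> u \<in> Lp_space m 2 \<and> (\<exists>l. ((\<lambda>t. approx_form m P t u u) \<longlongrightarrow> l) (at_right 0))"
  using form_semigroup by (auto simp: form_semigroup_def associated_def)

text \<open>
  Since \<open>f * g = 0\<close>, the difference quotient of the form reduces to its nonlocal part: on the one
  side \<open>- pairing m (P t g) f / t\<close>, on the other the integral of
  \<open>- (f x * g y + f y * g x) / 2\<close>, whose two summands have equal integrals by symmetry of \<open>J\<close>. So off
  the diagonal the measures \<open>P\<^sub>t(x, dy) m(dx) / t\<close> converge to \<open>J\<close> when tested on such products.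
\<close>

lemma offdiagonal_limit:
  assumes f: "f \<in> D" "continuous_on UNIV f" "\<And>x. 0 \<le> f x"
    and g: "g \<in> D" "continuous_on UNIV g" "\<And>x. 0 \<le> g x"
    and disjoint: "\<And>x. f x * g x = 0"
  shows "integrable J (\<lambda>z. f (fst z) * g (snd z))"
    and "((\<lambda>t. pairing m (P t g) f / t) \<longlongrightarrow> (\<integral>z. f (fst z) * g (snd z) \<partial>J)) (at_right 0)"
proof -
  define a where "a = (\<lambda>z. f (fst z) * g (snd z))"
  have cont_fst_snd: "continuous_on UNIV (\<lambda>z. h (fst z) :: real)" "continuous_on UNIV (\<lambda>z. h (snd z) :: real)"
    if "continuous_on UNIV h" for h :: "'a \<Rightarrow> real"
    using that by (auto intro!: continuous_on_compose2[of UNIV h] continuous_intros)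
  have "continuous_on UNIV a"
    unfolding a_def using f g by (intro continuous_intros cont_fst_snd)
  then have a_meas [measurable]: "a \<in> borel_measurable J"
    by (rule measurable_J_continuous)
  have a_nonneg: "0 \<le> a z" for z
    using f g by (simp add: a_def)
  have a_swap_meas: "(\<lambda>z. a (prod.swap z)) \<in> borel_measurable J"
    using measurable_compose[OF measurable_swap_J a_meas] .
  have "(g y - g x) * (f y - f x) = f x * g x + f y * g y - (f x * g y + f y * g x)" for x y
    by (simp add: algebra_simps)
  then have "(g y - g x) * (f y - f x) = - (f x * g y + f y * g x)" for x y
    by (simp only: disjoint)
  then have eq: "(\<lambda>(x, y). (g y - g x) * (f y - f x)) = (\<lambda>z. - (a z + a (prod.swap z)))"
    by (simp add: fun_eq_iff a_def)
  have "integrable J (\<lambda>z. - (a z + a (prod.swap z)))"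
    using jump_formula(1)[OF g(1) f(1) g(2) f(2)] unfolding eq .
  from Bochner_Integration.integrable_minus[OF this]
  have int_sum: "integrable J (\<lambda>z. a z + a (prod.swap z))"
    by (simp only: minus_minus)
  have int_a: "integrable J a"
    by (rule Bochner_Integration.integrable_bound[OF int_sum a_meas]) (use a_nonneg in auto)
  then show "integrable J (\<lambda>z. f (fst z) * g (snd z))"
    by (simp add: a_def)
  have int_a_swap: "integrable J (\<lambda>z. a (prod.swap z))"
    by (rule Bochner_Integration.integrable_bound[OF int_sum a_swap_meas]) (use a_nonneg in auto)
  have "(\<integral>z. a (prod.swap z) \<partial>J) = (\<integral>z. a z \<partial>distr J J prod.swap)"
    by (rule integral_distr[OF measurable_swap_J a_meas, symmetric])
  also have "\<dots> = (\<integral>z. a z \<partial>J)"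
    by (simp add: distr_swap_J)
  finally have "\<E> g f = - (\<integral>z. a z \<partial>J)"
    using jump_formula(2)[OF g(1) f(1) g(2) f(2)] int_a int_a_swap unfolding eq by simp
  then have "((\<lambda>t. - approx_form m P t g f) \<longlongrightarrow> (\<integral>z. a z \<partial>J)) (at_right 0)"
    using tendsto_minus[OF form_limit[OF g(1) f(1)]] by simp
  moreover have "- approx_form m P t g f = pairing m (P t g) f / t" for t
  proof -
    have "(g x - P t g x) * f x = - (P t g x * f x)" for x
      using disjoint[of x] by (simp only: left_diff_distrib mult.commute[of "g x"])
    then show ?thesis
      by (simp add: approx_form_def pairing_def)
  qed
  ultimately show "((\<lambda>t. pairing m (P t g) f / t) \<longlongrightarrow> (\<integral>z. f (fst z) * g (snd z) \<partial>J)) (at_right 0)"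
    by (simp add: a_def)
qed

text \<open>
  A continuous nonnegative \<open>H (v x) (v y)\<close> vanishing on the diagonal is approximated from below by
  sums of products of hat functions of \<open>v\<close>, with the infimum of \<open>H\<close> over the supports as
  coefficients. If two hats overlap, the product of their supports meets the diagonal and the
  coefficient is \<open>0\<close>; so only products with \<open>f i * f j = 0\<close> occur, which is what
  \<open>offdiagonal_limit\<close> requires. The central hat need not be in the domain when applied to \<open>v\<close>, and is cut
  off with the sequence of \<open>cutoff_sequence\<close>.
\<close>

lemma step_minorants:
  fixes H :: "real \<Rightarrow> real \<Rightarrow> real"
  assumes v: "v \<in> D" "continuous_on UNIV v"
    and H_cont: "continuous_on UNIV (\<lambda>z. H (fst z) (snd z))"
    and H_nonneg: "\<And>s r. 0 \<le> H s r"
    and H_diag: "\<And>s. H s s = 0"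
  obtains N :: "nat \<Rightarrow> nat" and f :: "nat \<Rightarrow> nat \<Rightarrow> 'a \<Rightarrow> real" and c :: "nat \<Rightarrow> nat \<Rightarrow> nat \<Rightarrow> real"
  where "\<And>n i. f n i \<in> D" "\<And>n i. continuous_on UNIV (f n i)" "\<And>n i x. 0 \<le> f n i x" "\<And>n i x. f n i x \<le> 1"
    "\<And>n i j. 0 \<le> c n i j" "\<And>n i j x. c n i j \<noteq> 0 \<Longrightarrow> f n i x * f n j x = 0"
    "\<And>n x y. (\<Sum>j<N n. \<Sum>i<N n. c n i j * (f n i x * f n j y)) \<le> H (v x) (v y)"
    "\<And>x y. (\<lambda>n. \<Sum>j<N n. \<Sum>i<N n. c n i j * (f n i x * f n j y)) \<longlonglongrightarrow> H (v x) (v y)"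
proof -
  obtain \<rho> :: "nat \<Rightarrow> 'a \<Rightarrow> real"
    where \<rho>: "\<And>n. \<rho> n \<in> D" "\<And>n. continuous_on UNIV (\<rho> n)" "\<And>n x. 0 \<le> \<rho> n x" "\<And>n x. \<rho> n x \<le> 1"
      "\<And>x. eventually (\<lambda>n. \<rho> n x = 1) sequentially"
    using cutoff_sequence by metis
  \<comment> \<open>The mesh is \<open>1 / Suc n\<close> and the hats cover the values of \<open>v\<close> up to \<open>Suc n\<close>, so \<open>M n\<close> of
    them are needed on either side of \<open>0\<close>.\<close>
  define M where "M n = Suc n * Suc n" for n
  define k where "k n i = real i - real (M n)" for n i
  define w where "w n = (\<lambda>x. real (Suc n) * v x)" for n
  define f where "f n i = (if i = M n then (\<lambda>x. max 0 (\<rho> n x - (1 - hat 0 (w n x)))) else (\<lambda>x. hat (k n i) (w n x)))" for n i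
  define S where "S n i j = {z. \<bar>real (Suc n) * fst z - k n i\<bar> \<le> 1 \<and> \<bar>real (Suc n) * snd z - k n j\<bar> \<le> 1}" for n i j
  define c where "c n i j = (INF z\<in>S n i j. H (fst z) (snd z))" for n i j
  define N where "N n = 2 * M n + 1" for n
  have w: "w n \<in> D" "continuous_on UNIV (w n)" for n
    unfolding w_def using v by (auto intro!: D_scale continuous_intros)
  have f_D: "f n i \<in> D" for n i
  proof (cases "i = M n")
    case True
    have complement: "1 - hat 0 (w n x) = ramp 0 (w n x) + ramp 0 (- 1 * w n x)" for x
      by (simp add: hat_0)
    have "(\<lambda>x. 1 - hat 0 (w n x)) \<in> D"
      unfolding complement by (intro D_add D_ramp D_scale w) auto
    then have "(\<lambda>x. min (max (\<rho> n x - (1 - hat 0 (w n x))) 0) 1) \<in> D"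
      by (intro D_unit_contraction D_diff[OF \<rho>(1)])
    moreover have "min (max (\<rho> n x - (1 - hat 0 (w n x))) 0) 1 = max 0 (\<rho> n x - (1 - hat 0 (w n x)))" for x
      using \<rho>(4)[of n x] hat_le_1[of 0 "w n x"] by (auto simp: min_def max_def)
    ultimately show ?thesis
      using True by (simp add: f_def)
  next
    case False
    then have "1 \<le> \<bar>k n i\<bar>"
      by (auto simp: k_def)
    then show ?thesis
      using False w by (simp add: f_def D_hat)
  qed
  have f_cont: "continuous_on UNIV (f n i)" for n i
    unfolding f_def using \<rho> w by (auto intro!: continuous_intros)
  have f_nonneg: "0 \<le> f n i x" for n i x
    by (simp add: f_def hat_nonneg)
  have f_le_hat: "f n i x \<le> hat (k n i) (w n x)" for n i x
    using \<rho>(4)[of n x] hat_nonneg[of 0 "w n x"] by (auto simp: f_def k_def)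
  have f_eq_hat: "f n i x = hat (k n i) (w n x)" if "\<rho> n x = 1" for n i x
    using that hat_nonneg[of 0 "w n x"] by (auto simp: f_def k_def)
  have f_le_1: "f n i x \<le> 1" for n i x
    using f_le_hat[of n i x] hat_le_1[of "k n i" "w n x"] by linarith
  have f_support: "\<bar>w n x - k n i\<bar> < 1" if "f n i x \<noteq> 0" for n i x
    using hat_support[of "k n i" "w n x"] f_le_hat[of n i x] f_nonneg[of n i x] that by fastforce
  have sum_f_le: "(\<Sum>i<N n. f n i x) \<le> 1" for n x
    using sum_mono[of "{..<N n}" "\<lambda>i. f n i x" "\<lambda>i. hat (k n i) (w n x)"] f_le_hat
      sum_hat_le_1[of "M n" "w n x"] by (auto simp: N_def k_def)
  have sum_f_eq: "(\<Sum>i<N n. f n i x) = 1" if "\<rho> n x = 1" "\<bar>v x\<bar> \<le> real (Suc n)" for n x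
  proof -
    have "\<bar>w n x\<bar> \<le> real (M n)"
      using that(2) by (simp add: w_def M_def abs_mult mult_left_mono del: of_nat_Suc mult_Suc mult_Suc_right)
    then show ?thesis
      using sum_hat_eq_1[of "w n x" "M n"] that(1) by (simp add: f_eq_hat N_def k_def)
  qed
  have bdd: "bdd_below ((\<lambda>z. H (fst z) (snd z)) ` S n i j)" for n i j
    using H_nonneg by (intro bdd_belowI2[where m = 0]) auto
  have centre: "(k n i / real (Suc n), k n j / real (Suc n)) \<in> S n i j" for n i j
    by (simp add: S_def del: of_nat_Suc)
  then have S_nonempty: "S n i j \<noteq> {}" for n i j
    by blast
  have c_nonneg: "0 \<le> c n i j" for n i j
    unfolding c_def using H_nonneg by (intro cINF_greatest S_nonempty) auto
  have in_S: "(v x, v y) \<in> S n i j" if "f n i x \<noteq> 0" "f n j y \<noteq> 0" for n i j x y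
    using f_support[OF that(1)] f_support[OF that(2)] by (simp add: S_def w_def)
  have c_disjoint: "f n i x * f n j x = 0" if "c n i j \<noteq> 0" for n i j x
  proof (rule ccontr)
    assume "f n i x * f n j x \<noteq> 0"
    then have "(v x, v x) \<in> S n i j"
      by (intro in_S) auto
    then have "c n i j \<le> H (v x) (v x)"
      unfolding c_def by (intro cINF_lower2[OF bdd]) auto
    then show False
      using c_nonneg[of n i j] that H_diag by simp
  qed
  have sum_split: "(\<Sum>j<N n. \<Sum>i<N n. C * (f n i x * f n j y)) =
      C * ((\<Sum>i<N n. f n i x) * (\<Sum>j<N n. f n j y))" for n x y C
    by (subst sum.swap) (unfold sum_product, simp only: sum_distrib_left)
  have upper: "(\<Sum>j<N n. \<Sum>i<N n. c n i j * (f n i x * f n j y)) \<le> H (v x) (v y)" for n x y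
  proof -
    have "(\<Sum>j<N n. \<Sum>i<N n. c n i j * (f n i x * f n j y)) \<le>
        (\<Sum>j<N n. \<Sum>i<N n. H (v x) (v y) * (f n i x * f n j y))"
    proof (intro sum_mono)
      fix i j
      show "c n i j * (f n i x * f n j y) \<le> H (v x) (v y) * (f n i x * f n j y)"
      proof (cases "f n i x = 0 \<or> f n j y = 0")
        case False
        then have "c n i j \<le> H (v x) (v y)"
          unfolding c_def using in_S[of n i x j y] by (intro cINF_lower2[OF bdd, of "(v x, v y)"]) auto
        then show ?thesis
          using f_nonneg by (intro mult_right_mono) auto
      qed auto
    qed
    also have "\<dots> = H (v x) (v y) * ((\<Sum>i<N n. f n i x) * (\<Sum>j<N n. f n j y))"
      by (rule sum_split)
    also have "\<dots> \<le> H (v x) (v y) * 1"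
      using sum_f_le f_nonneg H_nonneg
      by (intro mult_left_mono mult_le_one sum_nonneg) auto
    finally show ?thesis by simp
  qed
  have limit: "(\<lambda>n. \<Sum>j<N n. \<Sum>i<N n. c n i j * (f n i x * f n j y)) \<longlonglongrightarrow> H (v x) (v y)" for x y
  proof (rule order_tendstoI)
    fix a assume "H (v x) (v y) < a"
    then show "eventually (\<lambda>n. (\<Sum>j<N n. \<Sum>i<N n. c n i j * (f n i x * f n j y)) < a) sequentially"
      using upper by (intro always_eventually allI) (rule le_less_trans)
  next
    fix a assume "a < H (v x) (v y)"
    then obtain b where b: "a < b" "b < H (v x) (v y)"
      using dense by blast
    have "isCont (\<lambda>z. H (fst z) (snd z)) (v x, v y)"
      using H_cont by (simp add: continuous_on_eq_continuous_at)
    then have "((\<lambda>z. H (fst z) (snd z)) \<longlongrightarrow> H (v x) (v y)) (nhds (v x, v y))"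
      using tendsto_at_iff_tendsto_nhds[of "\<lambda>z. H (fst z) (snd z)" "(v x, v y)"]
      by (simp add: isCont_def)
    then have "eventually (\<lambda>z. b < H (fst z) (snd z)) (nhds (v x, v y))"
      using b(2) by (rule order_tendstoD)
    then obtain e where e: "0 < e" "\<And>z. dist z (v x, v y) < e \<Longrightarrow> b < H (fst z) (snd z)"
      unfolding eventually_nhds_metric by blast
    have large: "eventually (\<lambda>n. \<bar>v z\<bar> \<le> real (Suc n)) sequentially" for z
    proof -
      obtain n0 where "\<bar>v z\<bar> \<le> real n0" using real_arch_simple by blast
      then show ?thesis
        unfolding eventually_sequentially by (intro exI[of _ n0]) auto
    qed
    have "(\<lambda>n. 4 * inverse (real (Suc n))) \<longlonglongrightarrow> 4 * 0"
      by (intro tendsto_intros LIMSEQ_inverse_real_of_nat)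
    then have "eventually (\<lambda>n. 4 * inverse (real (Suc n)) < e) sequentially"
      using e(1) by (intro order_tendstoD) auto
    then show "eventually (\<lambda>n. a < (\<Sum>j<N n. \<Sum>i<N n. c n i j * (f n i x * f n j y))) sequentially"
      using \<rho>(5)[of x] \<rho>(5)[of y] large[of x] large[of y]
    proof eventually_elim
      case (elim n)
      have near: "\<bar>s - r\<bar> \<le> 2 * inverse (real (Suc n))"
        if "\<bar>real (Suc n) * s - l\<bar> \<le> 1" "\<bar>real (Suc n) * r - l\<bar> \<le> 1" for s r l
      proof -
        have "real (Suc n) * \<bar>s - r\<bar> = \<bar>real (Suc n) * s - real (Suc n) * r\<bar>"
          by (simp add: abs_mult flip: right_diff_distrib)
        also have "\<dots> \<le> 2"
          using that by linarith
        finally show ?thesis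
          by (simp add: field_simps)
      qed
      have c_ge: "b \<le> c n i j" if "f n i x \<noteq> 0" "f n j y \<noteq> 0" for i j
        unfolding c_def
      proof (rule cINF_greatest[OF S_nonempty])
        fix z assume z: "z \<in> S n i j"
        have "\<bar>fst z - v x\<bar> \<le> 2 * inverse (real (Suc n))" "\<bar>snd z - v y\<bar> \<le> 2 * inverse (real (Suc n))"
          using z in_S[OF that] by (auto simp: S_def simp del: of_nat_Suc intro!: near)
        moreover have "dist z (v x, v y) \<le> \<bar>fst z - v x\<bar> + \<bar>snd z - v y\<bar>"
          using sqrt_sum_squares_le_sum_abs[of "fst z - v x" "snd z - v y"]
          by (simp add: dist_prod_def dist_real_def)
        ultimately have "dist z (v x, v y) < e"
          using elim by linarith
        then show "b \<le> H (fst z) (snd z)"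
          using e(2) by (simp add: less_imp_le)
      qed
      have "b = b * ((\<Sum>i<N n. f n i x) * (\<Sum>j<N n. f n j y))"
        using elim by (simp add: sum_f_eq)
      also have "\<dots> = (\<Sum>j<N n. \<Sum>i<N n. b * (f n i x * f n j y))"
        by (rule sum_split[symmetric])
      also have "\<dots> \<le> (\<Sum>j<N n. \<Sum>i<N n. c n i j * (f n i x * f n j y))"
      proof (intro sum_mono)
        fix i j
        show "b * (f n i x * f n j y) \<le> c n i j * (f n i x * f n j y)"
        proof (cases "f n i x = 0 \<or> f n j y = 0")
          case False
          then show ?thesis
            using f_nonneg c_ge by (intro mult_right_mono) auto
        qed auto
      qed
      finally show ?case
        using b(1) by simp
    qed
  qed
  show ?thesis
    by (rule that[of f c N]) (fact f_D f_cont f_nonneg f_le_1 c_nonneg c_disjoint upper limit)+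
qed

text \<open>
  For each of the minorants the bound by \<open>Q t\<close> passes to the limit as \<open>t\<close> tends to \<open>0\<close> by
  \<open>offdiagonal_limit\<close>; then Fatou's lemma applies, since the minorants converge to \<open>H\<close> pointwise.
  The sign of \<open>L\<close> is recorded because \<open>ennreal\<close> sends negative numbers to \<open>0\<close>.
\<close>

lemma jump_lower_bound:
  fixes H :: "real \<Rightarrow> real \<Rightarrow> real"
  assumes v: "v \<in> D" "continuous_on UNIV v"
    and H: "continuous_on UNIV (\<lambda>z. H (fst z) (snd z))" "\<And>s r. 0 \<le> H s r" "\<And>s. H s s = 0"
    and Q: "(Q \<longlongrightarrow> L) (at_right 0)"
    and le: "\<And>t n (f :: nat \<Rightarrow> 'a \<Rightarrow> real) c. 0 < t \<Longrightarrow> (\<And>i. f i \<in> D) \<Longrightarrow> (\<And>i x. 0 \<le> f i x \<and> f i x \<le> 1) \<Longrightarrow>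
      (\<And>x y. (\<Sum>j<n. \<Sum>i<n. c i j * (f i x * f j y)) \<le> H (v x) (v y)) \<Longrightarrow>
      (\<Sum>j<n. \<Sum>i<n. c i j * (pairing m (P t (f j)) (f i) / t)) \<le> Q t"
  shows "0 \<le> L" and "(\<integral>\<^sup>+z. ennreal (H (v (fst z)) (v (snd z))) \<partial>J) \<le> ennreal L"
proof -
  have "eventually (\<lambda>t. 0 \<le> Q t) (at_right 0)"
    using eventually_at_right_less[of "0::real"]
    by eventually_elim (use le[where f = "\<lambda>i x. 0" and n = 0] D_zero H in simp)
  then show "0 \<le> L"
    using Q by (intro tendsto_lowerbound[of Q L "at_right 0"]) (auto simp: trivial_limit_at_right_real)
  obtain N :: "nat \<Rightarrow> nat" and f :: "nat \<Rightarrow> nat \<Rightarrow> 'a \<Rightarrow> real" and c :: "nat \<Rightarrow> nat \<Rightarrow> nat \<Rightarrow> real"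
    where f: "\<And>n i. f n i \<in> D" "\<And>n i. continuous_on UNIV (f n i)" "\<And>n i x. 0 \<le> f n i x" "\<And>n i x. f n i x \<le> 1"
      and c: "\<And>n i j. 0 \<le> c n i j" "\<And>n i j x. c n i j \<noteq> 0 \<Longrightarrow> f n i x * f n j x = 0"
      and upper: "\<And>n x y. (\<Sum>j<N n. \<Sum>i<N n. c n i j * (f n i x * f n j y)) \<le> H (v x) (v y)"
      and lim: "\<And>x y. (\<lambda>n. \<Sum>j<N n. \<Sum>i<N n. c n i j * (f n i x * f n j y)) \<longlonglongrightarrow> H (v x) (v y)"
    by (rule step_minorants[OF v H]) blast
  define h where "h n z = (\<Sum>j<N n. \<Sum>i<N n. c n i j * (f n i (fst z) * f n j (snd z)))" for n z
  have h_nonneg: "0 \<le> h n z" for n z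
    unfolding h_def using f c by (intro sum_nonneg mult_nonneg_nonneg) auto
  have term_int: "integrable J (\<lambda>z. c n i j * (f n i (fst z) * f n j (snd z)))"
    and term_lim: "((\<lambda>t. c n i j * (pairing m (P t (f n j)) (f n i) / t)) \<longlongrightarrow>
      (\<integral>z. c n i j * (f n i (fst z) * f n j (snd z)) \<partial>J)) (at_right 0)" for n i j
  proof -
    show "integrable J (\<lambda>z. c n i j * (f n i (fst z) * f n j (snd z)))"
    proof (cases "c n i j = 0")
      case False
      show ?thesis
        by (intro integrable_mult_right offdiagonal_limit(1) f c(2)[OF False])
    qed simp
    show "((\<lambda>t. c n i j * (pairing m (P t (f n j)) (f n i) / t)) \<longlongrightarrow>
        (\<integral>z. c n i j * (f n i (fst z) * f n j (snd z)) \<partial>J)) (at_right 0)"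
    proof (cases "c n i j = 0")
      case False
      show ?thesis
        unfolding integral_mult_right_zero
        by (intro tendsto_mult_left offdiagonal_limit(2) f c(2)[OF False])
    qed simp
  qed
  have h_int: "integrable J (h n)" for n
    unfolding h_def by (intro Bochner_Integration.integrable_sum term_int)
  have h_le: "(\<integral>z. h n z \<partial>J) \<le> L" for n
  proof -
    have "((\<lambda>t. \<Sum>j<N n. \<Sum>i<N n. c n i j * (pairing m (P t (f n j)) (f n i) / t)) \<longlongrightarrow>
        (\<Sum>j<N n. \<Sum>i<N n. \<integral>z. c n i j * (f n i (fst z) * f n j (snd z)) \<partial>J)) (at_right 0)"
      by (intro tendsto_sum term_lim)
    moreover have "(\<Sum>j<N n. \<Sum>i<N n. \<integral>z. c n i j * (f n i (fst z) * f n j (snd z)) \<partial>J) = (\<integral>z. h n z \<partial>J)"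
    proof -
      have "has_bochner_integral J (h n) (\<Sum>j<N n. \<Sum>i<N n. \<integral>z. c n i j * (f n i (fst z) * f n j (snd z)) \<partial>J)"
        unfolding h_def by (intro has_bochner_integral_sum has_bochner_integral_integrable term_int)
      then show ?thesis
        by (simp add: has_bochner_integral_iff)
    qed
    ultimately have "((\<lambda>t. \<Sum>j<N n. \<Sum>i<N n. c n i j * (pairing m (P t (f n j)) (f n i) / t)) \<longlongrightarrow>
        (\<integral>z. h n z \<partial>J)) (at_right 0)"
      by simp
    moreover have "eventually (\<lambda>t. (\<Sum>j<N n. \<Sum>i<N n. c n i j * (pairing m (P t (f n j)) (f n i) / t)) \<le> Q t)
        (at_right 0)"
      using eventually_at_right_less[of "0::real"]
      by eventually_elim (intro le f upper conjI; simp)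
    ultimately show ?thesis
      using Q by (intro tendsto_le[OF _ Q]) (auto simp: trivial_limit_at_right_real)
  qed
  have "(\<integral>\<^sup>+z. ennreal (H (v (fst z)) (v (snd z))) \<partial>J) = (\<integral>\<^sup>+z. liminf (\<lambda>n. ennreal (h n z)) \<partial>J)"
  proof (rule nn_integral_cong)
    fix z
    have "(\<lambda>n. ennreal (h n z)) \<longlonglongrightarrow> ennreal (H (v (fst z)) (v (snd z)))"
      unfolding h_def by (intro tendsto_ennrealI lim)
    then show "ennreal (H (v (fst z)) (v (snd z))) = liminf (\<lambda>n. ennreal (h n z))"
      by (simp add: lim_imp_Liminf)
  qed
  also have "\<dots> \<le> liminf (\<lambda>n. \<integral>\<^sup>+z. ennreal (h n z) \<partial>J)"
    using h_int by (intro nn_integral_liminf) auto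
  also have "\<dots> \<le> liminf (\<lambda>n. ennreal L)"
    using h_int h_nonneg h_le
    by (intro Liminf_mono always_eventually) (auto simp: nn_integral_eq_integral intro!: ennreal_leI)
  also have "\<dots> = ennreal L"
    by (simp add: Liminf_const)
  finally show "(\<integral>\<^sup>+z. ennreal (H (v (fst z)) (v (snd z))) \<partial>J) \<le> ennreal L" .
qed

lemma signed_powr_half_in_D:
  assumes "1 < p" "u \<in> p_form_domain m P p"
  shows "(\<lambda>x. signed_powr (u x) (p / 2)) \<in> D"
  using signed_powr_half_approx_form_convergent[OF assms] assms(2) signed_powr_Lp(1)[of u m p]
  by (simp add: in_D_iff p_form_domain_def)

text \<open>
  One application of \<open>jump_lower_bound\<close>, to \<open>F\<^sub>p\<close>, shows that the integral of \<open>F\<^sub>p\<close> is at most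
  \<open>p\<close> times the \<open>p\<close>-form. Another one, to \<open>G = C * (v y - v x)\<^sup>2 - F\<^sub>p\<close>, gives the reverse inequality,
  because for \<open>v = signed_powr u (p / 2)\<close> in the form domain the squared difference is known to
  integrate to exactly the limit of its approximations. To have functions of \<open>v\<close> alone, \<open>F\<^sub>p\<close> is
  expressed through \<open>v\<close> as \<open>B\<close>.
\<close>

lemma p_form_eq:
  assumes p: "1 < p" and u: "u \<in> p_form_domain m P p" and u_cont: "continuous_on UNIV u"
  shows "integrable J (\<lambda>(x, y). bregman p (u x) (u y))"
    and "p_form m P p u = 1 / p * (\<integral>(x, y). bregman p (u x) (u y) \<partial>J)"
proof -
  define v where "v = (\<lambda>x. signed_powr (u x) (p / 2))"
  define z where "z = (\<lambda>x. signed_powr (u x) (p - 1))"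
  define C where "C = 2 * max 1 (p - 1)"
  have C: "1 \<le> C" "p - 1 \<le> C"
    using p by (auto simp: C_def max_def)
  have uLp: "u \<in> Lp_space m p"
    using u by (simp add: p_form_domain_def)
  have v: "v \<in> D" "continuous_on UNIV v"
    using signed_powr_half_in_D[OF p u] u_cont p by (auto simp: v_def intro!: continuous_intros)
  define l where "l = p_form m P p u"
  have l: "((\<lambda>t. approx_form m P t u z) \<longlongrightarrow> l) (at_right 0)"
  proof -
    obtain l' where "((\<lambda>t. approx_form m P t u z) \<longlongrightarrow> l') (at_right 0)"
      using u unfolding p_form_domain_def z_def by auto
    moreover from this have "l = l'"
      unfolding l_def p_form_def z_def by (intro tendsto_Lim) (auto simp: trivial_limit_at_right_real)
    ultimately show ?thesis by simp
  qed
  define B where "B s r = bregman p (signed_powr s (2 / p)) (signed_powr r (2 / p))" for s r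
  have B_v: "B (v x) (v y) = bregman p (u x) (u y)" for x y
    using p by (simp add: B_def v_def signed_powr_signed_powr)
  have B_bounds: "0 \<le> B s r" "B s r \<le> C * (r - s)\<^sup>2" for s r
  proof -
    have eq: "signed_powr (signed_powr a (2 / p)) (p / 2) = a" for a
      using p by (simp add: signed_powr_signed_powr)
    have "0 \<le> min 1 (p - 1) / 2 * (r - s)\<^sup>2"
      using p by simp
    also have "\<dots> \<le> B s r"
      using bregman_comparison(1)[OF p, of "signed_powr r (2 / p)" "signed_powr s (2 / p)"]
      unfolding eq B_def .
    finally show "0 \<le> B s r" .
    show "B s r \<le> C * (r - s)\<^sup>2"
      using bregman_comparison(2)[OF p, of "signed_powr s (2 / p)" "signed_powr r (2 / p)"]
      unfolding eq B_def C_def .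
  qed
  have B_cont: "continuous_on UNIV (\<lambda>z. B (fst z) (snd z))"
    unfolding B_def bregman_eq using p
    by (intro continuous_intros continuous_on_powr') auto
  have B_meas: "(\<lambda>z. B (v (fst z)) (v (snd z))) \<in> borel_measurable J"
  proof (intro measurable_J_continuous)
    have "continuous_on UNIV (\<lambda>z. (v (fst z), v (snd z)))"
      by (intro continuous_intros continuous_on_compose2[OF v(2)]) auto
    from continuous_on_compose2[OF B_cont this] show "continuous_on UNIV (\<lambda>z. B (v (fst z)) (v (snd z)))"
      by simp
  qed
  define d where "d = (\<lambda>z. (v (snd z) - v (fst z))\<^sup>2)"
  have d_eq: "(\<lambda>(x, y). (v y - v x) * (v y - v x)) = d"
    by (auto simp: d_def power2_eq_square)
  have d_int: "integrable J d" and form_v: "\<E> v v = 1 / 2 * (\<integral>z. d z \<partial>J)"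
    using jump_formula[OF v(1,1) v(2,2)] unfolding d_eq by auto
  have B_int: "integrable J (\<lambda>z. B (v (fst z)) (v (snd z)))"
  proof (rule Bochner_Integration.integrable_bound[OF _ B_meas])
    show "integrable J (\<lambda>z. C * d z)"
      using d_int by simp
    show "AE z in J. norm (B (v (fst z)) (v (snd z))) \<le> norm (C * d z)"
      using B_bounds by (intro AE_I2) (auto simp: d_def intro: order_trans[OF _ abs_ge_self])
  qed
  define I where "I = (\<integral>z. B (v (fst z)) (v (snd z)) \<partial>J)"
  have compare_B: "(\<Sum>j<n. \<Sum>i<n. c i j * (pairing m (P t (f j)) (f i) / t)) \<le> p * approx_form m P t u z"
    if t: "0 < t" and f: "\<And>i. f i \<in> D" "\<And>i x. 0 \<le> f i x \<and> f i x \<le> 1"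
      and le: "\<And>x y. (\<Sum>j<n. \<Sum>i<n. c i j * (f i x * f j y)) \<le> B (v x) (v y)"
    for t n c and f :: "nat \<Rightarrow> 'a \<Rightarrow> real"
  proof -
    have "(\<Sum>j<n. \<Sum>i<n. c i j * (pairing m (P t (f j)) (f i) / t)) \<le>
        - 0 * approx_form m P t v v - (- p) * approx_form m P t u z"
      unfolding v_def z_def
    proof (rule powr_comparison[OF t p uLp, where \<alpha> = 1 and \<beta> = "p - 1"])
      show "(\<Sum>j<n. \<Sum>i<n. c i j * (f i x * f j y)) \<le>
          1 * \<bar>u y\<bar> powr p + (p - 1) * \<bar>u x\<bar> powr p +
          0 * (signed_powr (u x) (p / 2) * signed_powr (u y) (p / 2)) +
          - p * (signed_powr (u x) (p - 1) * u y)" for x y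
        using le[of x y] unfolding B_v bregman_eq by simp
      show "\<exists>C. \<forall>x\<in>space m. \<bar>f i x\<bar> \<le> C" for i
        using f by (intro exI[of _ 1]) auto
    qed (use p f D_L2 in auto)
    then show ?thesis
      by simp
  qed
  have lim_B: "((\<lambda>t. p * approx_form m P t u z) \<longlongrightarrow> p * l) (at_right 0)"
    by (intro tendsto_intros l)
  have B_diag: "B s s = 0" for s
    by (simp add: B_def bregman_def)
  have bound_B: "0 \<le> p * l" "(\<integral>\<^sup>+z. ennreal (B (v (fst z)) (v (snd z))) \<partial>J) \<le> ennreal (p * l)"
    by (rule jump_lower_bound[OF v B_cont B_bounds(1) B_diag lim_B]; rule compare_B; simp)+
  have "I \<le> p * l"
  proof -
    have "ennreal I = (\<integral>\<^sup>+z. ennreal (B (v (fst z)) (v (snd z))) \<partial>J)"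
      unfolding I_def using B_int B_bounds by (intro nn_integral_eq_integral[symmetric]) auto
    also note bound_B(2)
    finally show ?thesis
      by (simp only: ennreal_le_iff[OF bound_B(1)])
  qed
  moreover have "C * (\<integral>z. d z \<partial>J) - I \<le> C * (\<integral>z. d z \<partial>J) - p * l"
  proof -
    define G where "G s r = C * (r - s)\<^sup>2 - B s r" for s r
    have compare_G: "(\<Sum>j<n. \<Sum>i<n. c i j * (pairing m (P t (f j)) (f i) / t)) \<le>
        2 * C * approx_form m P t v v - p * approx_form m P t u z"
      if t: "0 < t" and f: "\<And>i. f i \<in> D" "\<And>i x. 0 \<le> f i x \<and> f i x \<le> 1"
        and le: "\<And>x y. (\<Sum>j<n. \<Sum>i<n. c i j * (f i x * f j y)) \<le> G (v x) (v y)"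
      for t n c and f :: "nat \<Rightarrow> 'a \<Rightarrow> real"
    proof -
      have "(\<Sum>j<n. \<Sum>i<n. c i j * (pairing m (P t (f j)) (f i) / t)) \<le>
          - (- 2 * C) * approx_form m P t v v - p * approx_form m P t u z"
        unfolding v_def z_def
      proof (rule powr_comparison[OF t p uLp, where \<alpha> = "C - 1" and \<beta> = "C - (p - 1)"])
        show "(\<Sum>j<n. \<Sum>i<n. c i j * (f i x * f j y)) \<le>
            (C - 1) * \<bar>u y\<bar> powr p + (C - (p - 1)) * \<bar>u x\<bar> powr p +
            - 2 * C * (signed_powr (u x) (p / 2) * signed_powr (u y) (p / 2)) +
            p * (signed_powr (u x) (p - 1) * u y)" for x y
          using le[of x y] unfolding G_def B_v bregman_eq
          by (simp add: v_def power2_diff signed_powr_half_square algebra_simps)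
        show "\<exists>C. \<forall>x\<in>space m. \<bar>f i x\<bar> \<le> C" for i
          using f by (intro exI[of _ 1]) auto
      qed (use p C f D_L2 in auto)
      then show ?thesis
        by simp
    qed
    have G_cont: "continuous_on UNIV (\<lambda>z. G (fst z) (snd z))"
      unfolding G_def by (intro continuous_intros B_cont)
    have G_nonneg: "0 \<le> G s r" and G_diag: "G s s = 0" for s r
      using B_bounds(2)[of s r] by (simp_all add: G_def B_diag)
    have lim_G: "((\<lambda>t. 2 * C * approx_form m P t v v - p * approx_form m P t u z) \<longlongrightarrow>
        2 * C * \<E> v v - p * l) (at_right 0)"
      by (intro tendsto_intros l form_limit v)
    have bound_G: "0 \<le> 2 * C * \<E> v v - p * l"
      "(\<integral>\<^sup>+z. ennreal (G (v (fst z)) (v (snd z))) \<partial>J) \<le> ennreal (2 * C * \<E> v v - p * l)"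
      by (rule jump_lower_bound[OF v G_cont G_nonneg G_diag lim_G]; rule compare_G; simp)+
    have G_eq: "G (v (fst z)) (v (snd z)) = C * d z - B (v (fst z)) (v (snd z))" for z
      by (simp add: G_def d_def)
    have "ennreal (C * (\<integral>z. d z \<partial>J) - I) = ennreal (\<integral>z. G (v (fst z)) (v (snd z)) \<partial>J)"
      using d_int B_int by (simp add: G_eq I_def)
    also have "\<dots> = (\<integral>\<^sup>+z. ennreal (G (v (fst z)) (v (snd z))) \<partial>J)"
    proof (rule nn_integral_eq_integral[symmetric])
      show "integrable J (\<lambda>z. G (v (fst z)) (v (snd z)))"
        using d_int B_int by (simp add: G_eq)
    qed (simp add: G_nonneg)
    also note bound_G(2)
    finally have "C * (\<integral>z. d z \<partial>J) - I \<le> 2 * C * \<E> v v - p * l"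
      by (simp only: ennreal_le_iff[OF bound_G(1)])
    then show ?thesis
      by (simp add: form_v)
  qed
  ultimately have "I = p * l"
    by simp
  have eq: "(\<lambda>z. B (v (fst z)) (v (snd z))) = (\<lambda>(x, y). bregman p (u x) (u y))"
    by (auto simp: B_v)
  show "integrable J (\<lambda>(x, y). bregman p (u x) (u y))"
    using B_int unfolding eq .
  show "p_form m P p u = 1 / p * (\<integral>(x, y). bregman p (u x) (u y) \<partial>J)"
    using \<open>I = p * l\<close> p unfolding I_def eq l_def[symmetric] by simp
qed

end

theorem theorem4p3:
  fixes m :: "'a::{metric_space, second_countable_topology} measure"
    and J :: "('a \<times> 'a) measure"
    and D :: "('a \<Rightarrow> real) set"
    and \<E> :: "('a \<Rightarrow> real) \<Rightarrow> ('a \<Rightarrow> real) \<Rightarrow> real"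
    and P :: "real \<Rightarrow> ('a \<Rightarrow> real) \<Rightarrow> 'a \<Rightarrow> real"
    and p :: real
    and u :: "'a \<Rightarrow> real"
  assumes "locally compact (UNIV :: 'a set)"
    and "radon_measure_on UNIV m"
    and "measure_support m = UNIV"
    and "radon_measure_on offdiag J"
    and "symmetric_measure J"
    and "dirichlet_form m D \<E>"
    and "regular_form m D \<E>"
    and "pure_jump m D \<E> J"
    and "form_semigroup m D \<E> P"
    and "conservative m P"
    and "1 < p"
    and "u \<in> p_form_domain m P p"
  shows "(\<lambda>x. signed_powr (u x) (p / 2)) \<in> D \<and>
    (continuous_on UNIV u \<longrightarrow>
       integrable J (\<lambda>(x, y). bregman p (u x) (u y)) \<and>
       p_form m P p u = 1 / p * (\<integral>(x, y). bregman p (u x) (u y) \<partial>J))"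
proof -
  interpret pure_jump_form m D \<E> J P
    using assms by unfold_locales (auto simp: radon_measure_on_def)
  show ?thesis
    using signed_powr_half_in_D p_form_eq assms(11,12) by blast
qed

end
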